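(* Let $n\in\mathbb{N}$, let $\Omega\subset\mathbb{R}^{n+1}$ be an axially symmetric domain with smooth boundary $\partial\Omega$, and let $D\subset\mathbb{C}_+$ be the projection of $\Omega$ onto the $(x_0,r)$-plane. Let $g$ be an $\mathbb{R}$-valued function on $\partial\Omega$ and $\lambda=\lambda_1+\underline{\omega}\lambda_2$ an $\mathbb{R}_{0,n}$-valued function of axial type on $\partial\Omega$, with $\lambda_1,\lambda_2$ being $\mathbb{R}$-valued. Then the Riemann-Hilbert boundary value problem of finding an axially monogenic function $\phi\in\mathcal{C}^1(\Omega,\mathbb{R}_{0,n})$ satisfying $$\mathcal{D}\phi(x)=0,\quad x\in\Omega,\qquad \mathrm{Re}\{\lambda(t)\phi(t)\}=g(t),\quad t\in\partial\Omega,$$ is equivalent, under the correspondence $\phi=A+\underline{\omega}B\leftrightarrow w=A+\mathrm{i}B$, to the problem of finding a continuously differentiable complex-valued function $w$ in $D$ satisfying $$\partial_{\bar z}w(z)+\frac{(n-1)\mathrm{i}}{4r}w(z)-\frac{(n-1)\mathrm{i}}{4r}\overline{w(z)}=0,\quad z=x_0+\mathrm{i}r\in D,\qquad \mathrm{Re}\{\lambda(z)w(z)\}=g(z),\quad z\in\partial D,$$ where $\partial_{\bar z}=\frac12(\partial_{x_0}+\mathrm{i}\partial_r)$, $g:\partial D\to\mathbb{R}$ is real-valued and $\lambda(z)=\lambda_1(z)+\mathrm{i}\lambda_2(z):\partial D\to\mathbb{C}$ is complex-valued.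
   Context: $\mathbb{R}_{0,n}$ is the real Clifford algebra generated by the orthonormal basis $e_1,\dots,e_n$ of $\mathbb{R}^n$ with $e_j^2=-1$ and $e_ie_j+e_je_i=0$ for $i\ne j$. Points of $\mathbb{R}^{n+1}$ are identified with $x=x_0+\underline{x}=x_0+\sum_{j=1}^n x_je_j$, with $\mathrm{Sc}(x)=x_0$; write $r=|\underline{x}|$ and $\underline{x}=r\underline{\omega}$ with $\underline{\omega}\in S^{n-1}=\{\underline{x}\in\mathbb{R}^n:|\underline{x}|=1\}$. An open set $\Omega$ is axially symmetric if for every $x\in\Omega$ the set $[x]=\{\mathrm{Sc}(x)+\mathcal{I}|\underline{x}|:\mathcal{I}\in S^{n-1}\}$ is contained in $\Omega$. $\mathbb{C}_+$ is the upper half of the $(x_0,r)$-plane, with complex coordinate $z=x_0+\mathrm{i}r$. The generalised Cauchy-Riemann operator is $\mathcal{D}=\partial_{x_0}+\sum_{j=1}^n e_j\partial_{x_j}$. A continuously differentiable function $\phi$ is monogenic if $\mathcal{D}\phi=0$. A function is of axial type if $\phi(x)=A(x_0,r)+\underline{\omega}B(x_0,r)$ with $\mathbb{R}$-valued $A,B$; then $\mathrm{Re}\,\phi=A$ and $\mathrm{Im}\,\phi=B$. An axially monogenic function is a monogenic function of axial type; equivalently, $A,B$ satisfy the Vekua system $\partial_{x_0}A-\partial_rB=\frac{n-1}{r}B$, $\partial_{x_0}B+\partial_rA=0$. All functions considered are of axial type, so $\lambda_1,\lambda_2,g$ depend only on $(x_0,r)$ and are also regarded as functions of $z=x_0+\mathrm{i}r\in\partial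 D$.
   Formalization: For n=1, solutions w must also be real on the axis r=0 (w=i corresponds to no φ). Where Ω meets the axis, w is C¹ up to r=0, the equation is imposed for r>0, and ∂D is the projection of ∂Ω. Boundary values are those of continuous extensions. *)

theory Defs
  imports "HOL-Analysis.Analysis"
begin

subsection \<open>The real Clifford algebra with negative definite signature\<close>

text \<open>
  The indices of the generators are the elements of a finite linearly ordered type 'n, so that
  n = CARD('n) is at least 1.  An element is given by its coordinates with respect to the basis of
  the blades (the products of the generators with index in A, in increasing order), where A ranges
  over all sets of indices.
\<close>

typedef 'n clifford = "UNIV :: (real ^ ('n::finite set)) set"
  morphisms coords Clifford ..

setup_lifting type_definition_clifford

text \<open>
  The product of the blades of A and B is this sign times the blade of the symmetric difference
  of A and B.  Sorting the factors contributes -1 for each pair with a > b, and each common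
  generator contributes its square -1.
\<close>

definition clifford_sign :: "'n::{finite,linorder} set \<Rightarrow> 'n set \<Rightarrow> real" where
  "clifford_sign A B = (-1) ^ card {(a, b). a \<in> A \<and> b \<in> B \<and> b \<le> a}"

instantiation clifford :: (finite) real_vector
begin

lift_definition zero_clifford :: "'a clifford" is 0 .
lift_definition plus_clifford :: "'a clifford \<Rightarrow> 'a clifford \<Rightarrow> 'a clifford" is "(+)" .
lift_definition minus_clifford :: "'a clifford \<Rightarrow> 'a clifford \<Rightarrow> 'a clifford" is "(-)" .
lift_definition uminus_clifford :: "'a clifford \<Rightarrow> 'a clifford" is uminus .
lift_definition scaleR_clifford :: "real \<Rightarrow> 'a clifford \<Rightarrow> 'a clifford" is scaleR .
instance
proof
  fix x y z :: "'a clifford" and a b :: real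
  show "x + y + z = x + (y + z)" by transfer simp
  show "x + y = y + x" by transfer simp
  show "0 + x = x" by transfer simp
  show "- x + x = 0" by transfer simp
  show "x - y = x + - y" by transfer simp
  show "a *\<^sub>R (x + y) = a *\<^sub>R x + a *\<^sub>R y" by transfer (simp add: scaleR_add_right)
  show "(a + b) *\<^sub>R x = a *\<^sub>R x + b *\<^sub>R x" by transfer (simp add: scaleR_add_left)
  show "a *\<^sub>R b *\<^sub>R x = (a * b) *\<^sub>R x" by transfer simp
  show "1 *\<^sub>R x = x" by transfer simp
qed

end

instantiation clifford :: (finite) real_inner
begin

lift_definition inner_clifford :: "'a clifford \<Rightarrow> 'a clifford \<Rightarrow> real" is inner .
lift_definition norm_clifford :: "'a clifford \<Rightarrow> real" is norm .

definition sgn_clifford :: "'a clifford \<Rightarrow> 'a clifford" where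
  "sgn_clifford x = x /\<^sub>R norm x"

definition dist_clifford :: "'a clifford \<Rightarrow> 'a clifford \<Rightarrow> real" where
  "dist_clifford x y = norm (x - y)"

definition uniformity_clifford :: "('a clifford \<times> 'a clifford) filter" where
  "uniformity_clifford = (INF e\<in>{0 <..}. principal {(x, y). dist x y < e})"

definition open_clifford :: "'a clifford set \<Rightarrow> bool" where
  "open_clifford U = (\<forall>x\<in>U. \<forall>\<^sub>F (x', y) in uniformity. x' = x \<longrightarrow> y \<in> U)"

instance
proof
  fix x y z :: "'a clifford" and a b :: real
  show "dist x y = norm (x - y)" by (rule dist_clifford_def)
  show "sgn x = x /\<^sub>R norm x" by (rule sgn_clifford_def)
  show "x \<bullet> y = y \<bullet> x" by transfer (rule inner_commute)
  show "(x + y) \<bullet> z = x \<bullet> z + y \<bullet> z" by transfer (rule inner_add_left)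
  show "(a *\<^sub>R x) \<bullet> y = a * (x \<bullet> y)" by transfer simp
  show "0 \<le> x \<bullet> x" by transfer simp
  show "(x \<bullet> x = 0) = (x = 0)" by transfer simp
  show "norm x = sqrt (x \<bullet> x)" by transfer (rule norm_eq_sqrt_inner)
next
  show "uniformity = (INF e\<in>{0 <..}. principal {(x :: 'a clifford, y). dist x y < e})"
    by (rule uniformity_clifford_def)
next
  fix U :: "'a clifford set"
  show "open U = (\<forall>x\<in>U. \<forall>\<^sub>F (x', y) in uniformity. x' = x \<longrightarrow> y \<in> U)"
    by (rule open_clifford_def)
qed

end

instantiation clifford :: (finite) euclidean_space
begin

lift_definition Basis_clifford :: "'a clifford set" is Basis .

instance
proof
  show "(Basis :: 'a clifford set) \<noteq> {}" by transfer simp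
  show "finite (Basis :: 'a clifford set)" by transfer simp
next
  fix u v x :: "'a clifford"
  show "u \<in> Basis \<Longrightarrow> v \<in> Basis \<Longrightarrow> u \<bullet> v = (if u = v then 1 else 0)"
    by transfer (rule inner_Basis)
  show "(\<forall>u\<in>Basis. x \<bullet> u = 0) = (x = 0)"
    by transfer (simp add: euclidean_all_zero_iff)
qed

end

lemma prod_sym_diff:
  fixes f :: "'b::finite \<Rightarrow> real"
  assumes "\<And>a. f a * f a = 1"
  shows "prod f (sym_diff A B) = prod f A * prod f B"
proof -
  have sq: "prod f (A \<inter> B) * prod f (A \<inter> B) = 1"
    by (simp add: assms flip: prod.distrib)
  have "prod f A = prod f (A - B) * prod f (A \<inter> B)"
    by (subst prod.union_disjoint[symmetric]) (auto intro!: prod.cong)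
  moreover have "prod f B = prod f (B - A) * prod f (A \<inter> B)"
    by (subst prod.union_disjoint[symmetric]) (auto intro!: prod.cong)
  moreover have "prod f (sym_diff A B) = prod f (A - B) * prod f (B - A)"
    by (rule prod.union_disjoint) auto
  ultimately have "prod f A * prod f B
      = prod f (sym_diff A B) * (prod f (A \<inter> B) * prod f (A \<inter> B))"
    by (simp only: mult.assoc mult.left_commute)
  then show ?thesis by (simp add: sq)
qed

lemma clifford_sign_prod:
  "clifford_sign A B = (\<Prod>a\<in>A. \<Prod>b\<in>B. if b \<le> a then -1 else 1)"
proof -
  have "(\<Prod>a\<in>A. \<Prod>b\<in>B. if b \<le> a then -1 else (1::real))
      = (\<Prod>p\<in>A \<times> B. if snd p \<le> fst p then -1 else 1)"
    by (simp add: prod.cartesian_product case_prod_beta)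
  also have "\<dots> = (\<Prod>p\<in>{p \<in> A \<times> B. snd p \<le> fst p}. -1)"
    by (rule prod.mono_neutral_cong_right) auto
  also have "{p \<in> A \<times> B. snd p \<le> fst p} = {(a, b). a \<in> A \<and> b \<in> B \<and> b \<le> a}"
    by auto
  finally show ?thesis by (simp add: clifford_sign_def)
qed

lemma clifford_sign_left: "clifford_sign (sym_diff A B) C = clifford_sign A C * clifford_sign B C"
  unfolding clifford_sign_prod
  by (rule prod_sym_diff) (simp add: if_distrib cong: if_cong flip: prod.distrib)

lemma clifford_sign_right: "clifford_sign A (sym_diff B C) = clifford_sign A B * clifford_sign A C"
proof -
  have "clifford_sign A (sym_diff B C) = (\<Prod>a\<in>A.
      (\<Prod>b\<in>B. if b \<le> a then -1 else 1) * (\<Prod>b\<in>C. if b \<le> a then -1 else 1))"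
    unfolding clifford_sign_prod by (intro prod.cong refl prod_sym_diff) auto
  then show ?thesis by (simp add: clifford_sign_prod prod.distrib)
qed

definition clifford_times ::
    "real ^ ('n::{finite,linorder} set) \<Rightarrow> real ^ ('n set) \<Rightarrow> real ^ ('n set)" where
  "clifford_times x y = (\<chi> C. \<Sum>A\<in>UNIV. \<Sum>B\<in>UNIV.
     if sym_diff A B = C then clifford_sign A B * x $ A * y $ B else 0)"

lemma clifford_times_nth:
  "clifford_times x y $ C
     = (\<Sum>A\<in>UNIV. clifford_sign A (sym_diff A C) * x $ A * y $ (sym_diff A C))"
proof -
  have "sym_diff A B = C \<longleftrightarrow> B = sym_diff A C" for A B :: "'a set" by auto
  then show ?thesis by (simp add: clifford_times_def)
qed

lemma clifford_times_assoc:
  "clifford_times (clifford_times x y) z = clifford_times x (clifford_times y z)"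
proof (rule vec_eq_iff[THEN iffD2], rule allI)
  fix E
  let ?s = clifford_sign
  have "clifford_times (clifford_times x y) z $ E
      = (\<Sum>D\<in>UNIV. \<Sum>A\<in>UNIV. ?s D (sym_diff D E) * (?s A (sym_diff A D) * x $ A * y $ (sym_diff A D))
           * z $ (sym_diff D E))"
    by (simp add: clifford_times_nth sum_distrib_left sum_distrib_right)
  also have "\<dots> = (\<Sum>A\<in>UNIV. \<Sum>D\<in>UNIV. ?s D (sym_diff D E)
      * (?s A (sym_diff A D) * x $ A * y $ (sym_diff A D)) * z $ (sym_diff D E))"
    by (rule sum.swap)
  also have "\<dots> = (\<Sum>A\<in>UNIV. \<Sum>B\<in>UNIV. ?s A (sym_diff A E) * x $ A
      * (?s B (sym_diff B (sym_diff A E)) * y $ B * z $ (sym_diff B (sym_diff A E))))"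
  proof (rule sum.cong[OF refl])
    fix A :: "'a set"
    have inv: "sym_diff A (sym_diff A B) = B" for B by auto
    have eq: "sym_diff B (sym_diff A E) = sym_diff (sym_diff A B) E" for B by auto
    have sgn: "?s (sym_diff A B) (sym_diff (sym_diff A B) E) * ?s A B
        = ?s A (sym_diff A E) * ?s B (sym_diff (sym_diff A B) E)" for B
    proof -
      have "?s P Q * ?s P Q = 1" for P Q :: "'a set"
        unfolding clifford_sign_def by (simp flip: power_add)
      from this[of A B] show ?thesis
        by (simp only: clifford_sign_left clifford_sign_right) algebra
    qed
    show "(\<Sum>D\<in>UNIV. ?s D (sym_diff D E) * (?s A (sym_diff A D) * x $ A * y $ (sym_diff A D))
          * z $ (sym_diff D E))
        = (\<Sum>B\<in>UNIV. ?s A (sym_diff A E) * x $ A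
            * (?s B (sym_diff B (sym_diff A E)) * y $ B * z $ (sym_diff B (sym_diff A E))))"
    proof (rule sum.reindex_bij_witness[where i = "sym_diff A" and j = "sym_diff A"])
      fix D
      show "?s A (sym_diff A E) * x $ A * (?s (sym_diff A D) (sym_diff (sym_diff A D) (sym_diff A E))
            * y $ (sym_diff A D) * z $ (sym_diff (sym_diff A D) (sym_diff A E)))
          = ?s D (sym_diff D E) * (?s A (sym_diff A D) * x $ A * y $ (sym_diff A D))
            * z $ (sym_diff D E)"
        using sgn[of "sym_diff A D"] unfolding eq inv by (simp add: mult_ac)
    qed (auto simp: inv)
  qed
  also have "\<dots> = clifford_times x (clifford_times y z) $ E"
    by (simp add: clifford_times_nth sum_distrib_left)
  finally show "clifford_times (clifford_times x y) z $ E
      = clifford_times x (clifford_times y z) $ E" .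
qed

lemma clifford_times_axis:
  "clifford_times (axis A a) (axis B b) = axis (sym_diff A B) (clifford_sign A B * a * b)"
proof (rule vec_eq_iff[THEN iffD2], rule allI)
  fix C
  have "clifford_times (axis A a) (axis B b) $ C
      = (\<Sum>A'\<in>UNIV. if A' = A then clifford_sign A (sym_diff A C) * a * axis B b $ sym_diff A C else 0)"
    unfolding clifford_times_nth by (intro sum.cong refl) (auto simp: axis_def)
  also have "\<dots> = clifford_sign A (sym_diff A C) * a * axis B b $ sym_diff A C"
    by simp
  also have "\<dots> = axis (sym_diff A B) (clifford_sign A B * a * b) $ C"
  proof -
    have "sym_diff A C = B \<longleftrightarrow> C = sym_diff A B" by auto
    then show ?thesis by (auto simp: axis_def)
  qed
  finally show "clifford_times (axis A a) (axis B b) $ C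
      = axis (sym_diff A B) (clifford_sign A B * a * b) $ C" .
qed

instantiation clifford :: ("{finite,linorder}") real_algebra_1
begin

lift_definition one_clifford :: "'a clifford" is "axis {} 1" .
lift_definition times_clifford :: "'a clifford \<Rightarrow> 'a clifford \<Rightarrow> 'a clifford" is clifford_times .

instance
proof
  fix x y z :: "'a clifford" and a :: real
  show "x * y * z = x * (y * z)" by transfer (rule clifford_times_assoc)
  show "(x + y) * z = x * z + y * z"
    by transfer (simp add: vec_eq_iff clifford_times_nth algebra_simps sum.distrib)
  show "x * (y + z) = x * y + x * z"
    by transfer (simp add: vec_eq_iff clifford_times_nth algebra_simps sum.distrib)
  show "a *\<^sub>R x * y = a *\<^sub>R (x * y)"
    by transfer (simp add: vec_eq_iff clifford_times_nth sum_distrib_left mult_ac)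
  show "x * a *\<^sub>R y = a *\<^sub>R (x * y)"
    by transfer (simp add: vec_eq_iff clifford_times_nth sum_distrib_left mult_ac)
  show "1 * x = x"
  proof (transfer, rule vec_eq_iff[THEN iffD2], rule allI)
    fix x :: "real ^ 'a set" and C :: "'a set"
    have "clifford_times (axis {} 1) x $ C = (\<Sum>A\<in>(UNIV :: 'a set set). if A = {} then x $ C else 0)"
      unfolding clifford_times_nth by (intro sum.cong refl) (auto simp: axis_def clifford_sign_def)
    then show "clifford_times (axis {} 1) x $ C = x $ C" by simp
  qed
  show "x * 1 = x"
  proof (transfer, rule vec_eq_iff[THEN iffD2], rule allI)
    fix x :: "real ^ 'a set" and C :: "'a set"
    have *: "sym_diff A C = {} \<longleftrightarrow> A = C" for A by auto
    have "clifford_times x (axis {} 1) $ C = (\<Sum>A\<in>UNIV. if A = C then x $ C else 0)"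
      unfolding clifford_times_nth
      by (intro sum.cong refl) (auto simp: axis_def clifford_sign_def *)
    then show "clifford_times x (axis {} 1) $ C = x $ C" by simp
  qed
  show "(0::'a clifford) \<noteq> 1" by transfer (simp add: axis_eq_0_iff)
qed

end

lift_definition blade :: "'n::finite set \<Rightarrow> 'n clifford" is "\<lambda>A. axis A 1" .

definition gen :: "'n::finite \<Rightarrow> 'n clifford" where
  "gen j = blade {j}"

lemma blade_mult: "blade A * blade B = clifford_sign A B *\<^sub>R blade (sym_diff A B)"
  by transfer (simp add: clifford_times_axis vec_eq_iff, simp add: axis_def)

lemma blade_empty: "blade {} = 1"
  by transfer simp

lemma gen_square: "gen j * gen j = -1"
proof -
  have "{(a, b). a = j \<and> b = j \<and> b \<le> a} = {(j, j)}" by auto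
  then show ?thesis by (simp add: gen_def blade_mult clifford_sign_def blade_empty)
qed

lemma gen_anticommute:
  assumes "i \<noteq> j"
  shows "gen i * gen j + gen j * gen i = 0"
proof -
  have "{(a, b). a = i \<and> b = j \<and> b \<le> a} = (if j \<le> i then {(i, j)} else {})" for i j :: 'a
    by auto
  moreover have "sym_diff {j} {i} = sym_diff {i} {j}" by auto
  ultimately show ?thesis
    using assms by (auto simp: gen_def blade_mult clifford_sign_def)
qed

lemma blade_insert:
  assumes "\<And>a. a \<in> A \<Longrightarrow> a < b"
  shows "blade (insert b A) = blade A * gen b"
proof -
  have pairs: "{(a, b'). a \<in> A \<and> b' = b \<and> b' \<le> a} = {}"
    using assms by fastforce
  have "sym_diff A {b} = insert b A"
    using assms by fastforce
  then show ?thesis by (simp add: gen_def blade_mult clifford_sign_def pairs)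
qed

definition Sc :: "'n::finite clifford \<Rightarrow> real" where
  "Sc a = coords a $ {}"

definition vec_embed :: "real ^ 'n \<Rightarrow> 'n::finite clifford" where
  "vec_embed v = (\<Sum>j\<in>UNIV. v $ j *\<^sub>R gen j)"


subsection \<open>Regularity of functions and of boundaries\<close>

text \<open>
  Derivatives are taken within S, so that for a relatively open subset of a closed half-plane
  this means continuous differentiability up to the bounding line.
\<close>

definition C1_on :: "'a::real_normed_vector set \<Rightarrow> ('a \<Rightarrow> 'b::real_normed_vector) \<Rightarrow> bool" where
  "C1_on S f \<longleftrightarrow> (\<exists>f' :: 'a \<Rightarrow> 'a \<Rightarrow>\<^sub>L 'b.
     (\<forall>x\<in>S. (f has_derivative blinfun_apply (f' x)) (at x within S)) \<and> continuous_on S f')"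

primrec Ck_on :: "nat \<Rightarrow> 'a::real_normed_vector set \<Rightarrow> ('a \<Rightarrow> 'b::real_normed_vector) \<Rightarrow> bool" where
  "Ck_on 0 U f \<longleftrightarrow> continuous_on U f"
| "Ck_on (Suc k) U f \<longleftrightarrow> (\<forall>x\<in>U. f differentiable (at x)) \<and>
     (\<forall>v. Ck_on k U (\<lambda>x. frechet_derivative f (at x) v))"

definition smooth_on :: "'a::real_normed_vector set \<Rightarrow> ('a \<Rightarrow> 'b::real_normed_vector) \<Rightarrow> bool" where
  "smooth_on U f \<longleftrightarrow> (\<forall>k. Ck_on k U f)"

definition smooth_boundary :: "'a::euclidean_space set \<Rightarrow> bool" where
  "smooth_boundary S \<longleftrightarrow> (\<forall>t\<in>frontier S. \<exists>U (\<rho> :: 'a \<Rightarrow> real).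
     open U \<and> t \<in> U \<and> smooth_on U \<rho> \<and>
     (\<forall>x\<in>U. frechet_derivative \<rho> (at x) \<noteq> (\<lambda>_. 0)) \<and>
     S \<inter> U = {x\<in>U. \<rho> x < 0} \<and> frontier S \<inter> U = {x\<in>U. \<rho> x = 0})"


subsection \<open>Axially monogenic functions\<close>

text \<open>Points of the (n+1)-dimensional space are pairs of the scalar part and the vector part.\<close>

type_synonym 'n space = "real \<times> (real, 'n) vec"

definition axially_symmetric :: "'n::finite space set \<Rightarrow> bool" where
  "axially_symmetric S \<longleftrightarrow>
     (\<forall>x\<in>S. \<forall>\<omega>. norm \<omega> = 1 \<longrightarrow> (fst x, norm (snd x) *\<^sub>R \<omega>) \<in> S)"

definition axial_proj :: "'n::finite space \<Rightarrow> complex" where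
  "axial_proj x = Complex (fst x) (norm (snd x))"

text \<open>
  At a point of the axis (zero vector part) every unit vector is an admissible direction, so there
  B has to vanish for A + \<omega> B to be single-valued.
\<close>

definition axial_on ::
    "'n::{finite,linorder} space set \<Rightarrow> ('n space \<Rightarrow> 'n clifford) \<Rightarrow>
     (complex \<Rightarrow> real) \<Rightarrow> (complex \<Rightarrow> real) \<Rightarrow> bool" where
  "axial_on S \<phi> A B \<longleftrightarrow> (\<forall>x\<in>S. \<forall>\<omega>. norm \<omega> = 1 \<and> snd x = norm (snd x) *\<^sub>R \<omega> \<longrightarrow>
     \<phi> x = of_real (A (axial_proj x)) + vec_embed \<omega> * of_real (B (axial_proj x)))"

definition cauchy_riemann ::
    "('n::{finite,linorder} space \<Rightarrow> 'n clifford) \<Rightarrow> 'n space \<Rightarrow> 'n clifford" where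
  "cauchy_riemann \<phi> x = frechet_derivative \<phi> (at x) (1, 0) +
     (\<Sum>j\<in>UNIV. gen j * frechet_derivative \<phi> (at x) (0, axis j 1))"

definition monogenic_on ::
    "'n::{finite,linorder} space set \<Rightarrow> ('n space \<Rightarrow> 'n clifford) \<Rightarrow> bool" where
  "monogenic_on S \<phi> \<longleftrightarrow> C1_on S \<phi> \<and> (\<forall>x\<in>S. cauchy_riemann \<phi> x = 0)"

definition axially_monogenic_on ::
    "'n::{finite,linorder} space set \<Rightarrow> ('n space \<Rightarrow> 'n clifford) \<Rightarrow> bool" where
  "axially_monogenic_on S \<phi> \<longleftrightarrow> monogenic_on S \<phi> \<and> (\<exists>A B. axial_on S \<phi> A B)"


subsection \<open>The two boundary value problems\<close>

text \<open>
  In both problems the boundary values are those of the continuous extension to the closure.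
\<close>

definition clifford_RHP ::
    "'n::{finite,linorder} space set \<Rightarrow> ('n space \<Rightarrow> 'n clifford) \<Rightarrow>
     ('n space \<Rightarrow> real) \<Rightarrow> ('n space \<Rightarrow> 'n clifford) \<Rightarrow> bool" where
  "clifford_RHP \<Omega> \<Lambda> g \<phi> \<longleftrightarrow>
     axially_monogenic_on \<Omega> \<phi> \<and> continuous_on (closure \<Omega>) \<phi> \<and>
     (\<forall>t\<in>frontier \<Omega>. Sc (\<Lambda> t * \<phi> t) = g t)"

definition dbar :: "(complex \<Rightarrow> complex) \<Rightarrow> complex \<Rightarrow> complex" where
  "dbar w z = (frechet_derivative w (at z) 1 + \<i> * frechet_derivative w (at z) \<i>) / 2"

text \<open>
  If the domain meets the axis r = 0, then so does its projection D.  On the axis the equation with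
  its coefficient 1/r makes no sense; instead w is continuously differentiable up to the axis, and
  the axis points of D do not belong to the boundary, which is taken relative to the closed upper
  half-plane.  If D lies in the open upper half-plane, C1_on is the usual notion and the equation
  holds on all of D.
\<close>

definition half_plane_boundary :: "complex set \<Rightarrow> complex set" where
  "half_plane_boundary D = (top_of_set {z. 0 \<le> Im z}) frontier_of D"

definition vekua_RHP ::
    "nat \<Rightarrow> complex set \<Rightarrow> (complex \<Rightarrow> complex) \<Rightarrow> (complex \<Rightarrow> real) \<Rightarrow> (complex \<Rightarrow> complex) \<Rightarrow> bool" where
  "vekua_RHP n D \<Lambda> g w \<longleftrightarrow>
     C1_on D w \<and> continuous_on (closure D) w \<and>
     (\<forall>z\<in>D. Im z > 0 \<longrightarrow>
        dbar w z + (of_nat n - 1) * \<i> / (4 * of_real (Im z)) * w z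
                 - (of_nat n - 1) * \<i> / (4 * of_real (Im z)) * cnj (w z) = 0) \<and>
     (\<forall>z\<in>half_plane_boundary D. Re (\<Lambda> z * w z) = g z)"

text \<open>
  This relates A + \<omega> B to A + \<i> B.  By the convention in axial_on, w is real on the axis
  points of the closure of D.  For n > 1 every solution of the Vekua equation which is
  continuously differentiable up to the axis has this property; for n = 1 the equation says that w
  is holomorphic, and the property has to be required (constant \<i> corresponds to no function
  \<phi>).
\<close>

definition corresponds ::
    "'n::{finite,linorder} space set \<Rightarrow> ('n space \<Rightarrow> 'n clifford) \<Rightarrow> (complex \<Rightarrow> complex) \<Rightarrow> bool" where
  "corresponds \<Omega> \<phi> w \<longleftrightarrow> axial_on (closure \<Omega>) \<phi> (\<lambda>z. Re (w z)) (\<lambda>z. Im (w z))"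

end

theory Submission
  imports Defs
begin

text \<open>
  Write s for the direction of the vector part of a point x and z = x_0 + ir for its projection.
  For a unit vector s the map a + ib \<mapsto> a + sb (\<open>axial_value\<close>) embeds the complex numbers in
  the Clifford algebra as an algebra, so that multiplication by i becomes left multiplication by
  s.  This settles the boundary condition: the scalar part of \<Lambda>\<phi> is the real part of
  \<lambda> w.  It also gives the identity behind the differential equations, namely that off the axis
  the Cauchy-Riemann operator applied to A + sB is the image under this embedding of twice the left
  hand side of the Vekua equation for w = A + iB (\<open>cauchy_riemann_axial_fun\<close>).  The extra
  coefficient (n-1)/r stems from the derivatives of s in the n - 1 directions orthogonal to s.

  Since w can be recovered from \<phi> along one meridian half-plane x_0 + r\<omega> by linear
  maps, all regularity of \<phi> passes to w.  The other direction needs care at the axis r = 0,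
  where s is discontinuous.  There B vanishes, hence so does \<partial>_0 B, and the second Vekua
  equation, extended to the axis by continuity, yields \<partial>_r A = 0.  Together with
  B/r \<rightarrow> \<partial>_r B (\<open>continuous_radial_quotient\<close>) this makes every term of the derivative of
  A + sB that contains s tend to 0 at the axis, so that A + sB is continuously differentiable
  there; the first Vekua equation, extended by continuity, says that it is monogenic there as well
  (\<open>monogenic_axial_fun\<close>).

  It remains to see that a solution w of the Vekua problem is real on the axis, for otherwise
  A + sB is not single-valued.  On axis points of D it is an assumption for n = 1, and
  for n > 1 it follows from (n-1)B = r(\<partial>_0 A - \<partial>_r B).  At an axis point of the boundary the smoothness of the
  boundary enters: by symmetry the normal has to point along the axis, so that axis points of D
  accumulate there (\<open>axis_boundary_point\<close>), and continuity of w gives the claim.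
\<close>

section \<open>The copy of the complex numbers spanned by 1 and a unit vector\<close>

lemma Sc_add [simp]: "Sc (a + b) = Sc a + Sc b"
  unfolding Sc_def by transfer simp

lemma Sc_scaleR [simp]: "Sc (c *\<^sub>R a) = c * Sc a"
  unfolding Sc_def by transfer simp

lemma Sc_of_real [simp]: "Sc (of_real c :: 'n::{finite,linorder} clifford) = c"
proof -
  have "Sc (1 :: 'n clifford) = 1"
    unfolding Sc_def by transfer (simp add: axis_def)
  then show ?thesis by (simp add: of_real_def)
qed

lemma Sc_vec_embed [simp]: "Sc (vec_embed v :: 'n::finite clifford) = 0"
proof -
  have sum: "Sc (sum f S) = (\<Sum>j\<in>S. Sc (f j))" if "finite S" for f :: "'n \<Rightarrow> 'n clifford" and S
    using that by (induction S) (simp_all, simp add: Sc_def zero_clifford.rep_eq)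
  have "Sc (gen j) = 0" for j :: 'n
    unfolding Sc_def gen_def by transfer (simp add: axis_def)
  then show ?thesis by (simp add: vec_embed_def sum)
qed

lemma linear_vec_embed: "linear vec_embed"
  by (rule linearI) (simp_all add: vec_embed_def algebra_simps sum.distrib scaleR_sum_right)

lemmas vec_embed_linear_simps [simp] =
  linear_0[OF linear_vec_embed] linear_add[OF linear_vec_embed]
  linear_diff[OF linear_vec_embed] linear_scale[OF linear_vec_embed]

lemma vec_embed_axis: "vec_embed (axis j 1) = gen j"
proof -
  have "vec_embed (axis j 1) = (\<Sum>i\<in>UNIV. if i = j then gen i else 0)"
    unfolding vec_embed_def by (intro sum.cong) (auto simp: axis_def)
  then show ?thesis by simp
qed

text \<open>
  Symmetrising the double sum over pairs of generators leaves only the diagonal terms, because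
  distinct generators anticommute.
\<close>

lemma vec_embed_square: "vec_embed v * vec_embed v = - of_real (v \<bullet> v)"
proof -
  have anti: "gen i * gen j + gen j * gen i = (if i = j then - 2 *\<^sub>R 1 else 0)" for i j :: 'a
  proof (cases "i = j")
    case True
    then show ?thesis by (simp add: gen_square scaleR_2)
  qed (simp add: gen_anticommute)
  have prod: "vec_embed v * vec_embed v = (\<Sum>i\<in>UNIV. \<Sum>j\<in>UNIV. (v $ i * v $ j) *\<^sub>R (gen i * gen j))"
    by (simp add: vec_embed_def sum_distrib_left sum_distrib_right scaleR_sum_right mult_ac)
       (subst sum.swap, simp add: mult_ac)
  have "2 *\<^sub>R (vec_embed v * vec_embed v) = vec_embed v * vec_embed v + vec_embed v * vec_embed v"
    by (rule scaleR_2)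
  also have "\<dots> = (\<Sum>i\<in>UNIV. \<Sum>j\<in>UNIV. (v $ i * v $ j) *\<^sub>R (gen i * gen j))
      + (\<Sum>j\<in>UNIV. \<Sum>i\<in>UNIV. (v $ i * v $ j) *\<^sub>R (gen i * gen j))"
    unfolding prod by (subst (2) sum.swap) rule
  also have "\<dots> = (\<Sum>i\<in>UNIV. \<Sum>j\<in>UNIV. (v $ i * v $ j) *\<^sub>R (gen i * gen j + gen j * gen i))"
    by (simp add: sum.distrib scaleR_add_right mult_ac)
  also have "\<dots> = (\<Sum>i\<in>UNIV. (v $ i * v $ i) *\<^sub>R (- 2 *\<^sub>R 1))"
    unfolding anti by (simp add: if_distrib cong: if_cong)
  also have "\<dots> = 2 *\<^sub>R (- of_real (v \<bullet> v))"
    by (simp add: inner_vec_def of_real_def scaleR_sum_left sum_negf scaleR_sum_right mult_ac)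
  finally show ?thesis by (simp only: scaleR_cancel_left) simp
qed

lemma Sc_vec_embed_square: "Sc (vec_embed v * vec_embed v) = - (v \<bullet> v)"
  unfolding vec_embed_square by (simp flip: of_real_minus)

definition axial_value :: "(real, 'n) vec \<Rightarrow> complex \<Rightarrow> 'n::{finite,linorder} clifford" where
  "axial_value v w = of_real (Re w) + Im w *\<^sub>R vec_embed v"

lemma mult_of_real_right: "a * of_real c = c *\<^sub>R (a :: 'n::{finite,linorder} clifford)"
  by (simp add: of_real_def)

lemma bounded_linear_axial_value: "bounded_linear (axial_value v)"
  unfolding axial_value_def linear_conv_bounded_linear[symmetric]
  by (rule linearI) (simp_all add: of_real_def algebra_simps)

text \<open>
  For a unit vector v this is a left inverse of \<open>axial_value v\<close>; being linear on the whole algebra,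
  it transfers continuity and differentiability from \<phi> to w.
\<close>

definition axial_components :: "(real, 'n) vec \<Rightarrow> 'n::{finite,linorder} clifford \<Rightarrow> complex" where
  "axial_components v a = Complex (Sc a) (- Sc (vec_embed v * a))"

lemma bounded_linear_axial_components: "bounded_linear (axial_components v)"
  unfolding axial_components_def linear_conv_bounded_linear[symmetric]
  by (rule linearI) (simp_all add: algebra_simps complex_eq_iff)

lemma axial_components_axial_value:
  assumes "norm v = 1"
  shows "axial_components v (axial_value v w) = w"
  using assms
  by (simp add: axial_components_def axial_value_def complex_eq_iff distrib_left
      mult_of_real_right Sc_vec_embed_square dot_square_norm)

lemma axial_value_eq_iff:
  assumes "norm v = 1"
  shows "axial_value v w = axial_value v w' \<longleftrightarrow> w = w'"
  by (metis assms axial_components_axial_value)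

text \<open>
  Here lies the equivalence of the boundary conditions: \<open>axial_value v\<close> is multiplicative when
  v squares to -1.
\<close>

lemma Sc_mult_axial_value:
  assumes "norm v = 1"
  shows "Sc (axial_value v l * axial_value v w) = Re (l * w)"
proof -
  have "of_real a * b = a *\<^sub>R b" for a :: real and b :: "'a clifford"
    by (simp add: of_real_def)
  with assms show ?thesis
    by (simp add: axial_value_def distrib_left distrib_right mult_of_real_right
        Sc_vec_embed_square dot_square_norm)
qed

lemma axial_value_mult_vec:
  assumes "norm v = 1"
  shows "vec_embed v * axial_value v w = axial_value v (\<i> * w)"
  using assms
  by (simp add: axial_value_def distrib_left distrib_right vec_embed_square
      mult_of_real_right dot_square_norm) (simp add: of_real_def)

lemma sum_gen_gen: "(\<Sum>j\<in>UNIV. gen j * gen j) = - of_real (real CARD('n)) * (1 :: 'n::{finite,linorder} clifford)"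
  by (simp add: gen_square)

lemma sum_gen_scaleR: "(\<Sum>j\<in>UNIV. (v $ j) *\<^sub>R gen j) = vec_embed v"
  by (simp add: vec_embed_def)

lemma axial_on_iff:
  "axial_on S \<phi> A B \<longleftrightarrow> (\<forall>x\<in>S. \<forall>\<omega>. norm \<omega> = 1 \<and> snd x = norm (snd x) *\<^sub>R \<omega> \<longrightarrow>
     \<phi> x = axial_value \<omega> (Complex (A (axial_proj x)) (B (axial_proj x))))"
  by (simp add: axial_on_def axial_value_def mult_of_real_right)

section \<open>Axially symmetric domains and their projections\<close>

text \<open>
  On the closed upper half-plane this is a section of \<open>axial_proj\<close> for every unit vector \<omega>.
\<close>

definition meridian :: "(real, 'n) vec \<Rightarrow> complex \<Rightarrow> 'n::finite space" where
  "meridian \<omega> z = (Re z, Im z *\<^sub>R \<omega>)"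

lemma bounded_linear_meridian: "bounded_linear (meridian \<omega>)"
  unfolding linear_conv_bounded_linear[symmetric]
  by (rule linearI) (simp_all add: meridian_def algebra_simps)

lemma axial_proj_meridian:
  assumes "norm \<omega> = 1" "0 \<le> Im z"
  shows "axial_proj (meridian \<omega> z) = z"
  using assms by (simp add: axial_proj_def meridian_def complex_eq_iff)

lemma Im_axial_proj: "Im (axial_proj x) = norm (snd x)"
  by (simp add: axial_proj_def)

lemma meridian_axial_proj:
  assumes "snd x = norm (snd x) *\<^sub>R \<omega>"
  shows "meridian \<omega> (axial_proj x) = x"
  using assms by (simp add: axial_proj_def meridian_def prod_eq_iff)

text \<open>
  On the axis every unit vector qualifies, so \<omega> is not a function of v.
\<close>

lemma direction_exists:
  fixes v :: "'a::euclidean_space"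
  obtains \<omega> where "norm \<omega> = 1" "v = norm v *\<^sub>R \<omega>"
proof (cases "v = 0")
  case True
  obtain b :: 'a where "b \<in> Basis"
    using nonempty_Basis by blast
  with True that[of b] show ?thesis by simp
next
  case False
  then show ?thesis
    using that[of "sgn v"] by (simp add: norm_sgn sgn_div_norm)
qed

lemma continuous_on_axial_proj [continuous_intros]: "continuous_on S axial_proj"
  unfolding axial_proj_def Complex_eq by (intro continuous_intros)

lemma continuous_on_meridian: "continuous_on S (meridian \<omega>)"
  unfolding meridian_def by (intro continuous_intros)

locale axial_domain =
  fixes \<Omega> :: "'n::{finite,linorder} space set" and D :: "complex set"
  assumes open_domain: "open \<Omega>"
    and symmetric: "axially_symmetric \<Omega>"
    and D_def: "D = axial_proj ` \<Omega>"
begin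

lemma Im_nonneg: "z \<in> D \<Longrightarrow> 0 \<le> Im z"
  by (auto simp: D_def Im_axial_proj)

lemma meridian_in_domain:
  assumes "z \<in> D" "norm \<omega> = 1"
  shows "meridian \<omega> z \<in> \<Omega>"
  using assms symmetric
  by (fastforce simp: D_def axially_symmetric_def meridian_def axial_proj_def)

text \<open>
  The meridians are continuous sections of \<open>axial_proj\<close> through every point of the space.  Hence
  an axially symmetric set is the full preimage of its projection, and closure and boundary pull back
  in the same way.
\<close>

lemma mem_domain_iff: "x \<in> \<Omega> \<longleftrightarrow> axial_proj x \<in> D"
proof
  assume D: "axial_proj x \<in> D"
  obtain \<omega> where "norm \<omega> = 1" "snd x = norm (snd x) *\<^sub>R \<omega>"
    by (rule direction_exists)
  with meridian_in_domain[OF D] show "x \<in> \<Omega>"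
    by (metis meridian_axial_proj)
qed (simp add: D_def)

lemma Im_nonneg_closure:
  assumes "z \<in> closure D"
  shows "0 \<le> Im z"
proof -
  have "closure D \<subseteq> {z. 0 \<le> Im z}"
    by (rule closure_minimal) (auto simp: Im_nonneg closed_halfspace_Im_ge)
  with assms show ?thesis by auto
qed

lemma meridian_in_closure:
  assumes "z \<in> closure D" "norm \<omega> = 1"
  shows "meridian \<omega> z \<in> closure \<Omega>"
proof -
  have "meridian \<omega> ` D \<subseteq> closure \<Omega>"
    using meridian_in_domain[OF _ assms(2)] closure_subset[of \<Omega>] by blast
  from image_closure_subset[OF continuous_on_meridian closed_closure this] assms(1)
  show ?thesis by blast
qed

lemma mem_closure_iff: "x \<in> closure \<Omega> \<longleftrightarrow> axial_proj x \<in> closure D"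
proof
  assume "x \<in> closure \<Omega>"
  then show "axial_proj x \<in> closure D"
    using image_closure_subset[OF continuous_on_axial_proj closed_closure, of \<Omega> D]
      closure_subset[of D] by (auto simp: D_def)
next
  assume D: "axial_proj x \<in> closure D"
  obtain \<omega> where "norm \<omega> = 1" "snd x = norm (snd x) *\<^sub>R \<omega>"
    by (rule direction_exists)
  with meridian_in_closure[OF D] show "x \<in> closure \<Omega>"
    by (metis meridian_axial_proj)
qed

lemma relatively_open: "openin (top_of_set {z. 0 \<le> Im z}) D"
proof -
  obtain \<omega> :: "(real, 'n) vec" where \<omega>: "norm \<omega> = 1"
    by (rule direction_exists)
  have "D = {z. 0 \<le> Im z} \<inter> meridian \<omega> -` \<Omega>"
    using meridian_in_domain[OF _ \<omega>] axial_proj_meridian[OF \<omega>]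
    by (auto simp: Im_nonneg) (metis mem_domain_iff)
  then show ?thesis
    using continuous_openin_preimage_gen[OF continuous_on_meridian open_domain] by metis
qed

lemma half_disc_in_domain:
  assumes "z \<in> D"
  obtains e where "e > 0" "\<And>z'. 0 \<le> Im z' \<Longrightarrow> dist z' z < e \<Longrightarrow> z' \<in> D"
  using relatively_open assms unfolding openin_euclidean_subtopology_iff by auto

text \<open>
  D is relatively open in the closed half-plane but not open in the plane if it contains axis points.
\<close>

lemma half_plane_boundary_eq: "half_plane_boundary D = closure D - D"
proof -
  let ?H = "{z. 0 \<le> Im z}"
  have "D \<subseteq> ?H" "closure D \<subseteq> ?H"
    using Im_nonneg Im_nonneg_closure by auto
  then show ?thesis
    using relatively_open
    by (simp add: half_plane_boundary_def frontier_of_def closure_of_subtopology interior_of_openin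
        Int_absorb1 inf.absorb2)
qed

lemma mem_frontier_iff: "x \<in> frontier \<Omega> \<longleftrightarrow> axial_proj x \<in> half_plane_boundary D"
  by (simp add: frontier_def interior_open open_domain half_plane_boundary_eq mem_closure_iff
      mem_domain_iff)

text \<open>
  Approaching an axis point of D vertically stays inside D.  This is the only way in which the Vekua
  equation, given for r > 0, yields information on the axis.
\<close>

lemma vanishes_on_axis:
  fixes f :: "complex \<Rightarrow> 'b::t2_space"
  assumes cont: "continuous_on D f" and off: "\<And>z. z \<in> D \<Longrightarrow> 0 < Im z \<Longrightarrow> f z = c" and z: "z \<in> D"
  shows "f z = c"
proof (cases "Im z = 0")
  case True
  obtain e where e: "e > 0" "\<And>z'. 0 \<le> Im z' \<Longrightarrow> dist z' z < e \<Longrightarrow> z' \<in> D"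
    using half_disc_in_domain[OF z] by blast
  let ?p = "\<lambda>t. z + \<i> * of_real t"
  have near: "\<forall>\<^sub>F t in at_right 0. 0 < t \<and> t < e"
    using e(1) by (auto simp: eventually_at_right_field)
  have "((\<lambda>t. f (?p t)) \<longlongrightarrow> f z) (at_right 0)"
  proof (rule continuous_on_tendsto_compose[OF cont _ z])
    show "(?p \<longlongrightarrow> z) (at_right 0)"
      by (auto intro!: tendsto_eq_intros)
    show "\<forall>\<^sub>F t in at_right 0. ?p t \<in> D"
      using near by eventually_elim (auto intro!: e(2) simp: True dist_norm norm_mult)
  qed
  moreover have "((\<lambda>t. f (?p t)) \<longlongrightarrow> c) (at_right 0)"
  proof (rule tendsto_eventually)
    show "\<forall>\<^sub>F t in at_right 0. f (?p t) = c"
      using near by eventually_elim (auto intro!: e(2) off simp: True dist_norm norm_mult)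
  qed
  ultimately show ?thesis
    by (rule tendsto_unique[rotated]) simp
qed (use off z Im_nonneg in fastforce)

end

section \<open>The Cauchy-Riemann operator off the axis\<close>

text \<open>
  Since \<open>sgn 0 = 0\<close>, the axis points are included with the value Re w.
\<close>

definition axial_fun :: "(complex \<Rightarrow> complex) \<Rightarrow> 'n space \<Rightarrow> 'n::{finite,linorder} clifford" where
  "axial_fun w x = axial_value (sgn (snd x)) (w (axial_proj x))"

text \<open>
  The derivative of A + s B at a point with direction s, where W is the derivative of A + iB and b
  stands for B/r: radial and axial increments are transported by W, and an increment orthogonal to s
  turns s and is therefore multiplied by B/r.  If \<partial>_r A, \<partial>_0 B and B vanish on
  the axis, then the same formula with s = 0 and b = \<partial>_r B gives the derivative there.
\<close>

definition axial_deriv ::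
    "(complex \<Rightarrow> complex) \<Rightarrow> real \<Rightarrow> (real, 'n) vec \<Rightarrow> 'n space \<Rightarrow> 'n::{finite,linorder} clifford" where
  "axial_deriv W b s h = axial_value s (W (Complex (fst h) (s \<bullet> snd h)))
     + b *\<^sub>R vec_embed (snd h - (s \<bullet> snd h) *\<^sub>R s)"

lemma linear_Complex:
  fixes W :: "complex \<Rightarrow> complex"
  assumes "linear W"
  shows "W (Complex a c) = of_real a * W 1 + of_real c * W \<i>"
proof -
  have "Complex a c = a *\<^sub>R 1 + c *\<^sub>R \<i>"
    by (simp add: complex_eq_iff)
  then have "W (Complex a c) = a *\<^sub>R W 1 + c *\<^sub>R W \<i>"
    using assms by (simp only: linear_add linear_scale)
  then show ?thesis
    by (simp add: scaleR_conv_of_real)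
qed

lemma axial_value_linear_simps:
  "axial_value v (w + w') = axial_value v w + axial_value v w'"
  "axial_value v (of_real c * w) = c *\<^sub>R axial_value v w"
  "axial_value v (w - w') = axial_value v w - axial_value v w'"
  "axial_value v 0 = 0"
  by (simp_all add: axial_value_def of_real_def algebra_simps)

lemma bounded_linear_axial_deriv:
  assumes "linear W"
  shows "bounded_linear (axial_deriv W b s)"
  unfolding linear_conv_bounded_linear[symmetric] axial_deriv_def linear_Complex[OF assms]
    axial_value_linear_simps
  by (rule linearI) (simp_all add: algebra_simps inner_add_right)

text \<open>
  The last term is the contribution of the rotation of s.  The number of directions orthogonal
  to s is n - 1 for a unit vector and n for s = 0.
\<close>

lemma cauchy_riemann_axial_deriv:
  fixes s :: "(real, 'n::{finite,linorder}) vec"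
  assumes "linear W"
  shows "axial_deriv W b s (1, 0) + (\<Sum>j\<in>UNIV. gen j * axial_deriv W b s (0, axis j 1))
    = axial_value s (W 1) + vec_embed s * axial_value s (W \<i>)
      - of_real (b * (real CARD('n) - s \<bullet> s))"
proof -
  have "axial_deriv W b s (0, axis j 1)
      = (s $ j) *\<^sub>R axial_value s (W \<i>) + b *\<^sub>R (gen j - (s $ j) *\<^sub>R vec_embed s)" for j
    by (simp add: axial_deriv_def linear_Complex[OF assms] axial_value_linear_simps inner_axis vec_embed_axis)
  then have "(\<Sum>j\<in>UNIV. gen j * axial_deriv W b s (0, axis j 1))
      = (\<Sum>j\<in>UNIV. gen j * ((s $ j) *\<^sub>R axial_value s (W \<i>) + b *\<^sub>R (gen j - (s $ j) *\<^sub>R vec_embed s)))"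
    by simp
  also have "\<dots> = (\<Sum>j\<in>UNIV. (s $ j) *\<^sub>R gen j) * axial_value s (W \<i>)
        + b *\<^sub>R ((\<Sum>j\<in>UNIV. gen j * gen j) - (\<Sum>j\<in>UNIV. (s $ j) *\<^sub>R gen j) * vec_embed s)"
    by (simp add: algebra_simps sum.distrib sum_subtractf sum_distrib_right scaleR_sum_right)
  also have "\<dots> = vec_embed s * axial_value s (W \<i>) - of_real (b * (real CARD('n) - s \<bullet> s))"
    unfolding sum_gen_scaleR vec_embed_square sum_gen_gen
    by (simp add: of_real_def algebra_simps)
  finally show ?thesis
    by (simp add: axial_deriv_def linear_Complex[OF assms])
qed

definition vekua_expr :: "nat \<Rightarrow> (complex \<Rightarrow> complex) \<Rightarrow> complex \<Rightarrow> complex" where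
  "vekua_expr n w z = dbar w z + (of_nat n - 1) * \<i> / (4 * of_real (Im z)) * w z
                 - (of_nat n - 1) * \<i> / (4 * of_real (Im z)) * cnj (w z)"

text \<open>
  Because w - cnj w = 2 \<i> Im w, the two terms of order zero combine to -(n - 1) Im w / (2 r).
\<close>

lemma vekua_expr_eq:
  assumes "(w has_derivative W) (at z)"
  shows "2 * vekua_expr n w z = W 1 + \<i> * W \<i> - of_real (Im (w z) / Im z * (real n - 1))"
proof -
  have W: "frechet_derivative w (at z) = W"
    using frechet_derivative_at[OF assms] by simp
  have "w z - cnj (w z) = 2 * \<i> * of_real (Im (w z))"
    by (simp add: complex_eq_iff)
  then have "vekua_expr n w z = dbar w z + (of_nat n - 1) * \<i> / (4 * of_real (Im z)) * (2 * \<i> * of_real (Im (w z)))"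
    by (metis (no_types) vekua_expr_def add_diff_eq right_diff_distrib)
  also have "\<dots> = (W 1 + \<i> * W \<i>) / 2 - of_real (Im (w z) / Im z * (real n - 1)) / 2"
    by (simp add: dbar_def W algebra_simps add_divide_distrib diff_divide_distrib)
  finally show ?thesis
    by simp
qed

lemma cauchy_riemann_has_derivative:
  assumes "(\<phi> has_derivative \<Phi>) (at x)"
  shows "cauchy_riemann \<phi> x = \<Phi> (1, 0) + (\<Sum>j\<in>UNIV. gen j * \<Phi> (0, axis j 1))"
  unfolding cauchy_riemann_def using frechet_derivative_at[OF assms] by simp

lemma has_derivative_axial_proj:
  assumes "snd x \<noteq> 0"
  shows "(axial_proj has_derivative (\<lambda>h. Complex (fst h) (sgn (snd x) \<bullet> snd h))) (at x)"
  unfolding axial_proj_def Complex_eq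
  by (rule derivative_eq_intros has_derivative_compose[OF _ has_derivative_norm] assms refl)+
     (simp add: inner_commute)

lemma has_derivative_sgn_snd:
  fixes x :: "'n::finite space"
  assumes "snd x \<noteq> 0"
  shows "((\<lambda>x. sgn (snd x)) has_derivative
     (\<lambda>h. (snd h - (sgn (snd x) \<bullet> snd h) *\<^sub>R sgn (snd x)) /\<^sub>R norm (snd x))) (at x)"
  unfolding sgn_div_norm
  by (rule derivative_eq_intros has_derivative_compose[OF _ has_derivative_norm] assms refl
    has_derivative_norm | simp add: assms)+
   (simp add: assms fun_eq_iff algebra_simps inner_commute sgn_div_norm power2_eq_square divide_simps)

lemma has_derivative_axial_fun:
  fixes x :: "'n::{finite,linorder} space"
  assumes x: "snd x \<noteq> 0" and w: "(w has_derivative W) (at (axial_proj x))"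
  shows "(axial_fun w has_derivative
    axial_deriv W (Im (w (axial_proj x)) / norm (snd x)) (sgn (snd x))) (at x)"
proof -
  have vec: "bounded_linear (vec_embed :: (real, 'n) vec \<Rightarrow> 'n clifford)"
    using linear_vec_embed by (simp add: linear_conv_bounded_linear)
  have wp: "((\<lambda>x. w (axial_proj x)) has_derivative (\<lambda>h. W (Complex (fst h) (sgn (snd x) \<bullet> snd h)))) (at x)"
    by (rule has_derivative_compose[OF has_derivative_axial_proj[OF x] w])
  show ?thesis
    unfolding axial_fun_def axial_value_def of_real_def
    by (rule has_derivative_eq_rhs,
        (rule has_derivative_add has_derivative_scaleR has_derivative_Re has_derivative_Im wp
          has_derivative_const has_derivative_compose[OF has_derivative_sgn_snd[OF x]
            bounded_linear_imp_has_derivative[OF vec]])+)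
      (simp add: axial_deriv_def axial_value_def fun_eq_iff of_real_def divide_inverse)
qed

text \<open>
  The two sides of the correspondence have the same differential equation: the real and imaginary
  parts of the Vekua equation are the components of the monogenicity equation along 1 and s.
\<close>

lemma cauchy_riemann_axial_fun:
  fixes x :: "'n::{finite,linorder} space"
  assumes x: "snd x \<noteq> 0" and w: "(w has_derivative W) (at (axial_proj x))"
  shows "cauchy_riemann (axial_fun w) x
    = axial_value (sgn (snd x)) (2 * vekua_expr CARD('n) w (axial_proj x))"
proof -
  have s: "norm (sgn (snd x)) = 1"
    using x by (simp add: norm_sgn)
  have "linear W"
    using w has_derivative_linear by blast
  then show ?thesis
    using s
    by (simp add: cauchy_riemann_has_derivative[OF has_derivative_axial_fun[OF x w]]
        cauchy_riemann_axial_deriv vekua_expr_eq[OF w] axial_value_mult_vec axial_value_linear_simps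
        dot_square_norm Im_axial_proj)
      (simp add: axial_value_def)
qed

section \<open>Regularity of Vekua solutions across the axis\<close>

text \<open>
  Used with g built from the direction of the vector part: the jump of g at the axis is harmless as
  long as its coefficient vanishes there.
\<close>

lemma continuous_on_scaleR_vanishing:
  fixes f :: "'a::t2_space \<Rightarrow> real" and g :: "'a \<Rightarrow> 'b::real_normed_vector"
  assumes f: "continuous_on S f" and g: "\<And>x. x \<in> S \<Longrightarrow> f x \<noteq> 0 \<Longrightarrow> continuous (at x within S) g"
    and K: "\<And>x. norm (g x) \<le> K"
  shows "continuous_on S (\<lambda>x. f x *\<^sub>R g x)"
  unfolding continuous_on_eq_continuous_within
proof
  fix x assume x: "x \<in> S"
  have fx: "continuous (at x within S) f"
    using f x by (simp add: continuous_on_eq_continuous_within)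
  show "continuous (at x within S) (\<lambda>x. f x *\<^sub>R g x)"
  proof (cases "f x = 0")
    case True
    with fx have "(f \<longlongrightarrow> 0) (at x within S)"
      by (simp add: continuous_within)
    then have "((\<lambda>y. f y *\<^sub>R g y) \<longlongrightarrow> 0) (at x within S)"
      by (rule tendsto_0_le[where K = K]) (simp add: K mult_left_mono)
    then show ?thesis
      by (simp add: continuous_within True)
  qed (intro continuous_intros fx g x)
qed

lemma continuous_sgn_snd:
  fixes x :: "'n::finite space"
  assumes "snd x \<noteq> 0"
  shows "continuous (at x within S) (\<lambda>x. sgn (snd x))"
  using has_derivative_continuous[OF has_derivative_sgn_snd[OF assms]] continuous_at_imp_continuous_at_within by blast

lemma axial_value_sgn_bound:
  obtains K where "K > 0"
    "\<And>v w. norm (axial_value (sgn v) w :: 'n::{finite,linorder} clifford) \<le> K * norm w"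
proof -
  obtain K where K: "K > 0" "\<And>v. norm (vec_embed v :: 'n clifford) \<le> K * norm v"
    using linear_bounded_pos[OF linear_vec_embed] by metis
  have "norm (axial_value (sgn v) w :: 'n clifford) \<le> (norm (1 :: 'n clifford) + K) * norm w" for v w
  proof -
    have "norm (vec_embed (sgn v) :: 'n clifford) \<le> K"
      using K(2)[of "sgn v"] K(1) by (simp add: norm_sgn split: if_splits)
    then have "norm (Im w *\<^sub>R (vec_embed (sgn v) :: 'n clifford)) \<le> norm w * K"
      by (simp add: abs_Im_le_cmod mult_mono)
    moreover have "norm (of_real (Re w) :: 'n clifford) \<le> norm w * norm (1 :: 'n clifford)"
      by (simp add: of_real_def abs_Re_le_cmod mult_right_mono)
    ultimately show ?thesis
      unfolding axial_value_def by (intro norm_triangle_le) (simp add: algebra_simps)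
  qed
  moreover have "norm (1 :: 'n clifford) + K > 0"
    using K(1) by (simp add: add_nonneg_pos)
  ultimately show ?thesis
    by (rule that[rotated])
qed

lemma vec_embed_sgn_bound:
  obtains K where "K > 0" "\<And>v. norm (vec_embed (sgn v) :: 'n::{finite,linorder} clifford) \<le> K"
proof -
  obtain K where K: "K > 0" "\<And>v w. norm (axial_value (sgn v) w :: 'n clifford) \<le> K * norm w"
    by (rule axial_value_sgn_bound) blast
  show ?thesis
    using that[OF K(1)] K(2)[of _ \<i>] by (simp add: axial_value_def)
qed

lemma continuous_vec_embed:
  "continuous F f \<Longrightarrow> continuous F (\<lambda>x. vec_embed (f x))"
  using linear_vec_embed bounded_linear.continuous linear_conv_bounded_linear by blast

lemma continuous_on_axial_fun:
  fixes S :: "'n::{finite,linorder} space set"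
  assumes w: "continuous_on (axial_proj ` S) w"
    and axis: "\<And>x. x \<in> S \<Longrightarrow> snd x = 0 \<Longrightarrow> Im (w (axial_proj x)) = 0"
  shows "continuous_on S (axial_fun w)"
proof -
  obtain K where K: "\<And>v. norm (vec_embed (sgn v) :: 'n clifford) \<le> K"
    by (rule vec_embed_sgn_bound) blast
  have wp: "continuous_on S (\<lambda>x. w (axial_proj x))"
    using w continuous_on_axial_proj by (rule continuous_on_compose2) simp
  have "continuous_on S (\<lambda>x. Im (w (axial_proj x)) *\<^sub>R (vec_embed (sgn (snd x)) :: 'n clifford))"
    using axis
    by (intro continuous_on_scaleR_vanishing[where K = K] K)
      (auto intro!: continuous_intros wp continuous_vec_embed continuous_sgn_snd)
  then show ?thesis
    unfolding axial_fun_def axial_value_def of_real_def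
    by (rule continuous_on_add[rotated]) (intro continuous_intros wp)
qed

context axial_domain
begin

lemma at_within_domain:
  assumes "z \<in> D" "0 < Im z"
  shows "at z within D = at z"
proof -
  obtain e where e: "e > 0" "\<And>z'. 0 \<le> Im z' \<Longrightarrow> dist z' z < e \<Longrightarrow> z' \<in> D"
    using half_disc_in_domain[OF assms(1)] by blast
  show ?thesis
  proof (rule at_within_nhd)
    show "z \<in> ball z e \<inter> {z. 0 < Im z}" "open (ball z e \<inter> {z. 0 < Im z})"
      using e(1) assms(2) by (auto simp: open_halfspace_Im_gt)
    show "D \<inter> (ball z e \<inter> {z. 0 < Im z}) - {z} = UNIV \<inter> (ball z e \<inter> {z. 0 < Im z}) - {z}"
      by (auto simp: dist_commute intro!: e(2))
  qed
qed

end

locale C1_in_axial_domain = axial_domain \<Omega> D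
  for \<Omega> :: "'n::{finite,linorder} space set" and D +
  fixes w :: "complex \<Rightarrow> complex" and w' :: "complex \<Rightarrow> complex \<Rightarrow>\<^sub>L complex"
  assumes has_derivative: "z \<in> D \<Longrightarrow> (w has_derivative w' z) (at z within D)"
    and continuous_deriv: "continuous_on D w'"
begin

lemma continuous_w [continuous_intros]: "continuous_on D w"
  by (rule has_derivative_continuous_on[OF has_derivative])

lemma continuous_deriv_apply [continuous_intros]: "continuous_on D (\<lambda>z. w' z h)"
  by (intro continuous_intros continuous_deriv)

lemma vekua_expr_deriv:
  assumes "z \<in> D" "0 < Im z"
  shows "2 * vekua_expr n w z = w' z 1 + \<i> * w' z \<i> - of_real (Im (w z) / Im z * (real n - 1))"
  using has_derivative[OF assms(1)] unfolding at_within_domain[OF assms] by (rule vekua_expr_eq)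

text \<open>
  Multiplying the real part of the equation by r gives
  r (\<partial>_0 A - \<partial>_r B) = (n - 1) B, and the left hand side tends to 0
  at the axis because the derivatives of w are continuous up to it.
\<close>

lemma vekua_solution_real_on_axis:
  assumes vekua: "\<And>z. z \<in> D \<Longrightarrow> 0 < Im z \<Longrightarrow> vekua_expr n w z = 0"
    and n: "n \<noteq> 1" and z: "z \<in> D" "Im z = 0"
  shows "Im (w z) = 0"
proof -
  let ?f = "\<lambda>z. Im z * Re (w' z 1 + \<i> * w' z \<i>) - (real n - 1) * Im (w z)"
  have "?f z = 0"
  proof (rule vanishes_on_axis[OF _ _ z(1)])
    show "continuous_on D ?f"
      by (intro continuous_intros)
    show "?f z = 0" if "z \<in> D" "0 < Im z" for z
      using vekua[OF that] vekua_expr_deriv[OF that, of n] that(2)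
      by (simp add: complex_eq_iff field_simps)
  qed
  with n z(2) show ?thesis by simp
qed

end

locale real_on_axis = C1_in_axial_domain +
  assumes real_on_axis: "z \<in> D \<Longrightarrow> Im z = 0 \<Longrightarrow> Im (w z) = 0"
begin

text \<open>
  The continuous extension of B/r to the axis, where B vanishes.
\<close>

definition radial_quotient :: "complex \<Rightarrow> real" where
  "radial_quotient z = (if Im z = 0 then Im (w' z \<i>) else Im (w z) / Im z)"

text \<open>
  The mean value theorem on the vertical segment from the axis.
\<close>

lemma radial_quotient_eq_deriv:
  assumes segment: "\<And>t. 0 \<le> t \<Longrightarrow> t \<le> Im z \<Longrightarrow> Complex (Re z) t \<in> D" and z: "0 < Im z"
  obtains t where "0 < t" "t < Im z" "radial_quotient z = Im (w' (Complex (Re z) t) \<i>)"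
proof -
  let ?p = "\<lambda>t. Complex (Re z) t"
  have "((\<lambda>t. Im (w (?p t))) has_derivative (\<lambda>h. Im (w' (?p t) (of_real h * \<i>)))) (at t within {0..Im z})"
    if "0 \<le> t" "t \<le> Im z" for t
  proof -
    have p: "(?p has_derivative (\<lambda>h. of_real h * \<i>)) (at t within {0..Im z})"
      unfolding Complex_eq by (auto intro!: derivative_eq_intros)
    have "?p ` {0..Im z} \<subseteq> D"
      using segment by auto
    then have "(w has_derivative w' (?p t)) (at (?p t) within ?p ` {0..Im z})"
      by (rule has_derivative_subset[OF has_derivative[OF segment[OF that]]])
    from has_derivative_Im[OF diff_chain_within[OF p this]] show ?thesis
      by (simp add: o_def)
  qed
  from mvt_simple[OF z this] obtain t where t: "0 < t" "t < Im z"
    "Im (w (?p (Im z))) - Im (w (?p 0)) = Im (w' (?p t) (of_real (Im z) * \<i>))"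
    by auto
  have "w' (?p t) (of_real (Im z) * \<i>) = Im z *\<^sub>R w' (?p t) \<i>"
    by (simp flip: scaleR_conv_of_real add: blinfun.scaleR_right)
  moreover have "Im (w (?p 0)) = 0"
    using real_on_axis segment[of 0] z by simp
  ultimately show ?thesis
    using t z that[of t] by (simp add: radial_quotient_def)
qed

lemma continuous_radial_quotient [continuous_intros]: "continuous_on D radial_quotient"
  unfolding continuous_on_iff
proof (intro ballI allI impI)
  fix z and \<epsilon> :: real assume z: "z \<in> D" and \<epsilon>: "\<epsilon> > 0"
  show "\<exists>d>0. \<forall>y\<in>D. dist y z < d \<longrightarrow> dist (radial_quotient y) (radial_quotient z) < \<epsilon>"
  proof (cases "Im z = 0")
    case False
    let ?q = "\<lambda>z. Im (w z) / Im z" and ?S = "{z \<in> D. Im z \<noteq> 0}"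
    have "continuous_on ?S ?q"
      by (intro continuous_intros continuous_on_subset[OF continuous_w]) auto
    with False z \<epsilon> obtain d where d: "d > 0" "\<And>y. y \<in> ?S \<Longrightarrow> dist y z < d \<Longrightarrow> dist (?q y) (?q z) < \<epsilon>"
      unfolding continuous_on_iff by blast
    have "Im y \<noteq> 0" if "dist y z < \<bar>Im z\<bar>" for y
      using that abs_Im_le_cmod[of "y - z"] by (auto simp: dist_norm)
    then show ?thesis
      using d False by (intro exI[of _ "min d \<bar>Im z\<bar>"]) (auto simp: radial_quotient_def)
  next
    case True
    let ?c = "\<lambda>z. Im (w' z \<i>)"
    have "continuous_on D ?c"
      by (intro continuous_intros)
    with z \<epsilon> obtain d where d: "d > 0" "\<And>y. y \<in> D \<Longrightarrow> dist y z < d \<Longrightarrow> dist (?c y) (?c z) < \<epsilon>"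
      unfolding continuous_on_iff by blast
    obtain e where e: "e > 0" "\<And>z'. 0 \<le> Im z' \<Longrightarrow> dist z' z < e \<Longrightarrow> z' \<in> D"
      using half_disc_in_domain[OF z] by blast
    have "dist (radial_quotient y) (radial_quotient z) < \<epsilon>" if y: "y \<in> D" "dist y z < min d e" for y
    proof (cases "Im y = 0")
      case y0: True
      with y d True show ?thesis
        by (simp add: radial_quotient_def)
    next
      case False
      then have "0 < Im y"
        using Im_nonneg[OF y(1)] by simp
      have near: "dist (Complex (Re y) t) z \<le> dist y z" if "0 \<le> t" "t \<le> Im y" for t
        using that True by (simp add: dist_norm cmod_def power_mono)
      obtain t where t: "0 < t" "t < Im y" "radial_quotient y = ?c (Complex (Re y) t)"
      proof (rule radial_quotient_eq_deriv[OF _ \<open>0 < Im y\<close>])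
        show "Complex (Re y) t \<in> D" if "0 \<le> t" "t \<le> Im y" for t
          using near[OF that] that y(2) by (intro e(2)) auto
      qed
      have "Complex (Re y) t \<in> D" "dist (Complex (Re y) t) z < d"
        using near[of t] t y(2) e(2)[of "Complex (Re y) t"] by auto
      with d t True show ?thesis
        by (simp add: radial_quotient_def)
    qed
    then show ?thesis
      using d e by (intro exI[of _ "min d e"]) auto
  qed
qed

text \<open>
  B is zero along the axis, so its derivative in that direction is zero as well.
\<close>

lemma tangential_deriv_real_on_axis:
  assumes z: "z \<in> D" "Im z = 0"
  shows "Im (w' z 1) = 0"
proof -
  obtain e where e: "e > 0" "\<And>z'. 0 \<le> Im z' \<Longrightarrow> dist z' z < e \<Longrightarrow> z' \<in> D"
    using half_disc_in_domain[OF z(1)] by blast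
  let ?p = "\<lambda>t. z + of_real t" and ?I = "ball 0 e :: real set"
  have p: "(?p has_derivative of_real) (at 0 within ?I)"
    by (auto intro!: derivative_eq_intros)
  have pD: "?p t \<in> D" "Im (?p t) = 0" if "t \<in> ?I" for t
    using that z by (auto intro!: e(2) simp: dist_norm)
  then have "?p ` ?I \<subseteq> D"
    by auto
  then have "(w has_derivative w' z) (at (?p 0) within ?p ` ?I)"
    using has_derivative_subset[OF has_derivative[OF z(1)]] by simp
  from has_derivative_Im[OF diff_chain_within[OF p this]]
  have "((\<lambda>t. Im (w (?p t))) has_derivative (\<lambda>h. Im (w' z (of_real h)))) (at 0)"
    using e(1) by (simp add: o_def at_within_open[of 0 ?I])
  moreover have "((\<lambda>t. Im (w (?p t))) has_derivative (\<lambda>h. 0)) (at 0)"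
    by (rule has_derivative_transform_within_open[OF has_derivative_const, of ?I])
      (use e(1) pD real_on_axis in auto)
  ultimately have "(\<lambda>h. Im (w' z (of_real h))) = (\<lambda>h. 0)"
    by (rule has_derivative_unique)
  from fun_cong[OF this, of 1] show ?thesis by simp
qed

end

context C1_in_axial_domain
begin

lemma upper_point:
  assumes "x \<in> \<Omega>" "snd x \<noteq> 0"
  shows "axial_proj x \<in> D" "0 < Im (axial_proj x)"
    "(w has_derivative w' (axial_proj x)) (at (axial_proj x))"
  using assms has_derivative[of "axial_proj x"] at_within_domain[of "axial_proj x"]
  by (auto simp: mem_domain_iff Im_axial_proj)

text \<open>
  \<open>axial_value s\<close> is injective for a unit vector s, so the identity for the Cauchy-Riemann operator
  can be read backwards.
\<close>

lemma vekua_if_monogenic: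
  assumes mono: "\<And>x. x \<in> \<Omega> \<Longrightarrow> cauchy_riemann (axial_fun w) x = 0"
    and z: "z \<in> D" "0 < Im z"
  shows "vekua_expr CARD('n) w z = 0"
proof -
  obtain \<omega> :: "(real, 'n) vec" where \<omega>: "norm \<omega> = 1"
    by (rule direction_exists)
  let ?x = "meridian \<omega> z"
  have x: "?x \<in> \<Omega>" "axial_proj ?x = z"
    using \<omega> z by (simp_all add: meridian_in_domain axial_proj_meridian)
  have "snd ?x \<noteq> 0"
    using \<omega> z by (auto simp: meridian_def)
  note x = x this
  have "axial_value (sgn (snd ?x)) (2 * vekua_expr CARD('n) w z) = 0"
    using mono[OF x(1)] cauchy_riemann_axial_fun[OF x(3)] upper_point(3)[OF x(1,3)] x(2) by metis
  then have "axial_value (sgn (snd ?x)) (2 * vekua_expr CARD('n) w z) = axial_value (sgn (snd ?x)) 0"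
    by (simp add: axial_value_linear_simps)
  then show ?thesis
    using x(3) by (subst (asm) axial_value_eq_iff) (simp_all add: norm_sgn)
qed

end

locale vekua_solution = real_on_axis \<Omega> D w w'
  for \<Omega> :: "'n::{finite,linorder} space set" and D w w' +
  assumes vekua: "z \<in> D \<Longrightarrow> 0 < Im z \<Longrightarrow> vekua_expr CARD('n) w z = 0"
begin

lemma vekua_up_to_axis:
  assumes "z \<in> D"
  shows "w' z 1 + \<i> * w' z \<i> - of_real ((real CARD('n) - 1) * radial_quotient z) = 0"
proof (rule vanishes_on_axis[OF _ _ assms])
  show "continuous_on D (\<lambda>z. w' z 1 + \<i> * w' z \<i> - of_real ((real CARD('n) - 1) * radial_quotient z))"
    by (intro continuous_intros)
  show "w' z 1 + \<i> * w' z \<i> - of_real ((real CARD('n) - 1) * radial_quotient z) = 0"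
    if "z \<in> D" "0 < Im z" for z
    using vekua_expr_deriv[OF that, of "CARD('n)"] vekua[OF that] that(2)
    by (simp add: radial_quotient_def mult.commute)
qed

text \<open>
  The second Vekua equation, \<partial>_0 B + \<partial>_r A = 0, persists on the axis, where
  \<partial>_0 B = 0.
\<close>

lemma normal_deriv_imaginary_on_axis:
  assumes z: "z \<in> D" "Im z = 0"
  shows "Re (w' z \<i>) = 0"
  using arg_cong[OF vekua_up_to_axis[OF z(1)], of Im] tangential_deriv_real_on_axis[OF z] by simp

definition deriv_ext :: "'n space \<Rightarrow> 'n space \<Rightarrow> 'n clifford" where
  "deriv_ext x = axial_deriv (w' (axial_proj x)) (radial_quotient (axial_proj x)) (sgn (snd x))"

lemma linear_w': "linear (blinfun_apply (w' z))"
  by (simp add: linear_conv_bounded_linear blinfun.bounded_linear_right)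

lemma bounded_linear_deriv_ext: "bounded_linear (deriv_ext x)"
  unfolding deriv_ext_def by (rule bounded_linear_axial_deriv[OF linear_w'])

text \<open>
  On the axis the real part of the extended equation reads
  \<partial>_0 A - \<partial>_r B = (n - 1) \<partial>_r B, that is, \<partial>_0 A = n \<partial>_r B, which is what the
  n equal terms of the vector part of the operator cancel.
\<close>

lemma cauchy_riemann_deriv_ext:
  assumes "x \<in> \<Omega>"
  shows "deriv_ext x (1, 0) + (\<Sum>j\<in>UNIV. gen j * deriv_ext x (0, axis j 1)) = 0"
proof -
  let ?z = "axial_proj x" and ?s = "sgn (snd x)"
  have z: "?z \<in> D"
    using assms by (simp add: mem_domain_iff)
  show ?thesis
  proof (cases "snd x = 0")
    case True
    then have z0: "Im ?z = 0"
      by (simp add: Im_axial_proj)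
    have "Re (w' ?z 1) = real CARD('n) * radial_quotient ?z"
      using arg_cong[OF vekua_up_to_axis[OF z], of Re] z0 by (simp add: radial_quotient_def algebra_simps)
    then show ?thesis
      unfolding deriv_ext_def cauchy_riemann_axial_deriv[OF linear_w']
      by (simp add: True axial_value_def mult.commute)
  next
    case False
    then have s: "norm ?s = 1"
      by (simp add: norm_sgn)
    have "axial_value ?s (w' ?z 1 + \<i> * w' ?z \<i> - of_real ((real CARD('n) - 1) * radial_quotient ?z)) = 0"
      unfolding vekua_up_to_axis[OF z] by (simp add: axial_value_linear_simps)
    then show ?thesis
      unfolding deriv_ext_def cauchy_riemann_axial_deriv[OF linear_w']
        axial_value_linear_simps axial_value_mult_vec[OF s, symmetric]
      using s by (simp add: dot_square_norm mult.commute) (simp add: axial_value_def)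
  qed
qed

text \<open>
  Every term containing the discontinuous direction s has a coefficient that vanishes on the axis:
  \<partial>_r A, \<partial>_0 B and \<partial>_r B - B/r.
\<close>

lemma continuous_deriv_ext: "continuous_on \<Omega> (\<lambda>x. deriv_ext x h)"
proof -
  obtain K where K: "K > 0" "\<And>v. norm (vec_embed (sgn v) :: 'n clifford) \<le> K"
    by (rule vec_embed_sgn_bound) blast
  have proj: "continuous_on \<Omega> (\<lambda>x. f (axial_proj x))" if "continuous_on D f"
    for f :: "complex \<Rightarrow> real"
    using that continuous_on_axial_proj by (rule continuous_on_compose2) (simp add: D_def)
  let ?vec = "vec_embed :: (real, 'n) vec \<Rightarrow> 'n clifford"
  let ?a = "\<lambda>z. Re (w' z 1)" and ?a' = "\<lambda>z. Re (w' z \<i>)"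
    and ?b = "\<lambda>z. Im (w' z 1)" and ?b' = "\<lambda>z. Im (w' z \<i>) - radial_quotient z"
  let ?c = "\<lambda>x. sgn (snd x) \<bullet> snd h"
  have axis: "snd x \<noteq> 0" if "x \<in> \<Omega>" "f (axial_proj x) \<noteq> 0"
    "\<And>z. z \<in> D \<Longrightarrow> Im z = 0 \<Longrightarrow> f z = 0" for x and f :: "complex \<Rightarrow> real"
    using that by (auto simp: mem_domain_iff Im_axial_proj)
  have c: "\<bar>?c x\<bar> \<le> norm (snd h)" for x :: "'n space"
    using Cauchy_Schwarz_ineq2[of "sgn (snd x)" "snd h"] by (auto simp: norm_sgn split: if_splits)
  have f: "continuous_on \<Omega> (\<lambda>x. ?a' (axial_proj x))" "continuous_on \<Omega> (\<lambda>x. ?b (axial_proj x))"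
    "continuous_on \<Omega> (\<lambda>x. ?b' (axial_proj x))"
    by (rule proj, intro continuous_intros)+
  have 1: "continuous_on \<Omega> (\<lambda>x. ?a' (axial_proj x) *\<^sub>R (?c x *\<^sub>R (1 :: 'n clifford)))"
  proof (rule continuous_on_scaleR_vanishing[where K = "norm (snd h) * norm (1 :: 'n clifford)"])
    show "continuous (at x within \<Omega>) (\<lambda>x. ?c x *\<^sub>R (1 :: 'n clifford))"
      if "x \<in> \<Omega>" "?a' (axial_proj x) \<noteq> 0" for x
      using axis[of x ?a', OF that normal_deriv_imaginary_on_axis] by (intro continuous_intros continuous_sgn_snd)
  qed (auto intro!: f mult_right_mono c)
  have 2: "continuous_on \<Omega> (\<lambda>x. ?b (axial_proj x) *\<^sub>R ?vec (sgn (snd x)))"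
  proof (rule continuous_on_scaleR_vanishing[where K = K])
    show "continuous (at x within \<Omega>) (\<lambda>x. ?vec (sgn (snd x)))"
      if "x \<in> \<Omega>" "?b (axial_proj x) \<noteq> 0" for x
      using axis[of x ?b, OF that tangential_deriv_real_on_axis]
      by (intro continuous_vec_embed continuous_sgn_snd)
  qed (auto intro!: f K)
  have 3: "continuous_on \<Omega> (\<lambda>x. ?b' (axial_proj x) *\<^sub>R (?c x *\<^sub>R ?vec (sgn (snd x))))"
  proof (rule continuous_on_scaleR_vanishing[where K = "norm (snd h) * K"])
    have "snd x \<noteq> 0" if "x \<in> \<Omega>" "?b' (axial_proj x) \<noteq> 0" for x
      using axis[of x ?b'] that by (simp add: radial_quotient_def)
    then show "continuous (at x within \<Omega>) (\<lambda>x. ?c x *\<^sub>R ?vec (sgn (snd x)))"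
      if "x \<in> \<Omega>" "?b' (axial_proj x) \<noteq> 0" for x
      using that by (intro continuous_intros continuous_vec_embed continuous_sgn_snd)
  qed (auto intro!: f mult_mono c K)
  have "deriv_ext x h = (fst h * ?a (axial_proj x)) *\<^sub>R 1
      + ?a' (axial_proj x) *\<^sub>R (?c x *\<^sub>R 1)
      + fst h *\<^sub>R (?b (axial_proj x) *\<^sub>R ?vec (sgn (snd x)))
      + ?b' (axial_proj x) *\<^sub>R (?c x *\<^sub>R ?vec (sgn (snd x)))
      + radial_quotient (axial_proj x) *\<^sub>R ?vec (snd h)" for x
    unfolding deriv_ext_def axial_deriv_def linear_Complex[OF linear_w'] axial_value_linear_simps
    by (simp add: axial_value_def of_real_def algebra_simps)
  then show ?thesis
    by (simp only:) (intro continuous_on_add 1 3 continuous_on_scaleR continuous_on_const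
        continuous_on_mult 2 proj continuous_on_Re continuous_deriv_apply continuous_radial_quotient)
qed

text \<open>
  At an axis point the linearisation error of \<phi> in y is the image of the linearisation error of w
  in the projection of y under \<open>axial_value\<close> in the direction of y, and these maps are
  bounded uniformly in the direction.
\<close>

lemma has_derivative_axial_fun_on_axis:
  assumes x: "x \<in> \<Omega>" "snd x = 0"
  shows "(axial_fun w has_derivative deriv_ext x) (at x)"
proof -
  let ?z = "axial_proj x"
  have z: "?z \<in> D" "Im ?z = 0"
    using x by (simp_all add: mem_domain_iff Im_axial_proj)
  obtain K where K: "K > 0" "\<And>v c. norm (axial_value (sgn v) c :: 'n clifford) \<le> K * norm c"
    by (rule axial_value_sgn_bound) blast
  have error: "axial_fun w y - axial_fun w x - deriv_ext x (y - x)
      = axial_value (sgn (snd y)) (w (axial_proj y) - w ?z - w' ?z (axial_proj y - ?z))" for y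
  proof -
    have diff: "axial_proj y - ?z = Complex (fst y - fst x) (norm (snd y))"
      using x(2) by (simp add: axial_proj_def complex_eq_iff)
    have "norm (snd y) *\<^sub>R vec_embed (sgn (snd y)) = (vec_embed (snd y) :: 'n clifford)"
      by (cases "snd y = 0") (simp_all add: sgn_div_norm)
    moreover have "(Im (w' ?z \<i>) * norm (snd y)) *\<^sub>R vec_embed (sgn (snd y))
        = Im (w' ?z \<i>) *\<^sub>R (norm (snd y) *\<^sub>R (vec_embed (sgn (snd y)) :: 'n clifford))"
      by simp
    ultimately show ?thesis
      using x(2) z real_on_axis[OF z] normal_deriv_imaginary_on_axis[OF z] tangential_deriv_real_on_axis[OF z]
      unfolding diff linear_Complex[OF linear_w'] deriv_ext_def axial_deriv_def axial_fun_def
      by (simp add: axial_value_def radial_quotient_def algebra_simps)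
  qed
  have dist: "norm (axial_proj y - ?z) = norm (y - x)" for y
    using x(2) by (simp add: axial_proj_def cmod_def norm_prod_def)
  have "(axial_fun w has_derivative deriv_ext x) (at x within \<Omega>)"
    unfolding has_derivative_within_alt
  proof (intro conjI allI impI bounded_linear_deriv_ext)
    fix \<epsilon> :: real assume "\<epsilon> > 0"
    then have "\<epsilon> / K > 0"
      using K(1) by simp
    then obtain d where d: "d > 0" "\<And>u. u \<in> D \<Longrightarrow> norm (u - ?z) < d \<Longrightarrow>
        norm (w u - w ?z - w' ?z (u - ?z)) \<le> \<epsilon> / K * norm (u - ?z)"
      using has_derivative[OF z(1)] unfolding has_derivative_within_alt by metis
    have "norm (axial_fun w y - axial_fun w x - deriv_ext x (y - x)) \<le> \<epsilon> * norm (y - x)"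
      if "y \<in> \<Omega>" "norm (y - x) < d" for y
    proof -
      have "axial_proj y \<in> D"
        using that(1) by (simp add: mem_domain_iff)
      with d that(2) have "norm (w (axial_proj y) - w ?z - w' ?z (axial_proj y - ?z)) \<le> \<epsilon> / K * norm (y - x)"
        unfolding dist[symmetric] by blast
      with K show ?thesis
        unfolding error by (intro order_trans[OF K(2)]) (simp add: field_simps)
    qed
    then show "\<exists>d>0. \<forall>y\<in>\<Omega>. norm (y - x) < d \<longrightarrow>
        norm (axial_fun w y - axial_fun w x - deriv_ext x (y - x)) \<le> \<epsilon> * norm (y - x)"
      using d(1) by blast
  qed
  then show ?thesis
    using at_within_open[OF x(1) open_domain] by simp
qed

lemma has_derivative_ext:
  assumes "x \<in> \<Omega>"
  shows "(axial_fun w has_derivative deriv_ext x) (at x)"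
proof (cases "snd x = 0")
  case False
  from has_derivative_axial_fun[OF False upper_point(3)[OF assms False]] upper_point(2)[OF assms False]
  show ?thesis
    by (simp add: deriv_ext_def radial_quotient_def Im_axial_proj)
qed (rule has_derivative_axial_fun_on_axis[OF assms])

lemma monogenic_axial_fun: "monogenic_on \<Omega> (axial_fun w)"
  unfolding monogenic_on_def C1_on_def
proof (intro conjI ballI exI)
  fix x assume x: "x \<in> \<Omega>"
  show "(axial_fun w has_derivative blinfun_apply (Blinfun (deriv_ext x))) (at x within \<Omega>)"
    using has_derivative_ext[OF x] has_derivative_at_withinI
    by (simp add: bounded_linear_Blinfun_apply bounded_linear_deriv_ext)
  show "cauchy_riemann (axial_fun w) x = 0"
    using cauchy_riemann_has_derivative[OF has_derivative_ext[OF x]] cauchy_riemann_deriv_ext[OF x]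
    by simp
next
  show "continuous_on \<Omega> (\<lambda>x. Blinfun (deriv_ext x))"
    by (rule continuous_on_blinfun_componentwise)
      (simp add: bounded_linear_Blinfun_apply bounded_linear_deriv_ext continuous_deriv_ext)
qed

end

section \<open>Boundary points on the axis\<close>

text \<open>
  L is the derivative of a defining function of the boundary: along a direction in which it decreases,
  the line enters the set on one side and leaves it on the other.
\<close>

lemma smooth_boundary_crossing:
  fixes S :: "'a::euclidean_space set"
  assumes smooth: "smooth_boundary S" and x: "x \<in> frontier S"
  obtains L :: "'a \<Rightarrow> real" where "linear L" "L \<noteq> (\<lambda>_. 0)"
    "\<And>v. L v < 0 \<Longrightarrow> \<forall>\<^sub>F h in at_right 0. x + h *\<^sub>R v \<in> S \<and> x - h *\<^sub>R v \<notin> S"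
proof -
  obtain U and \<rho> :: "'a \<Rightarrow> real" where U: "open U" "x \<in> U" "smooth_on U \<rho>"
      "\<forall>y\<in>U. frechet_derivative \<rho> (at y) \<noteq> (\<lambda>_. 0)"
      "S \<inter> U = {y \<in> U. \<rho> y < 0}" "frontier S \<inter> U = {y \<in> U. \<rho> y = 0}"
    using bspec[OF smooth[unfolded smooth_boundary_def] x] by (elim exE conjE) (rule that)
  let ?L = "frechet_derivative \<rho> (at x)"
  have "Ck_on (Suc 0) U \<rho>"
    using U(3) unfolding smooth_on_def by blast
  with U(2) have \<rho>: "(\<rho> has_derivative ?L) (at x)"
    by (simp add: frechet_derivative_works)
  have L: "linear ?L"
    using \<rho> by (rule has_derivative_linear)
  have \<rho>x: "\<rho> x = 0"
    using x U(2,6) by blast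
  have "\<forall>\<^sub>F h in at_right 0. x + h *\<^sub>R v \<in> S \<and> x - h *\<^sub>R v \<notin> S" if v: "?L v < 0" for v
  proof -
    let ?f = "\<lambda>h. \<rho> (x + h *\<^sub>R v)"
    have line: "((\<lambda>h. x + h *\<^sub>R v) has_derivative (\<lambda>h. h *\<^sub>R v)) (at 0)"
      by (auto intro!: derivative_eq_intros)
    have "(?f has_derivative (\<lambda>h. ?L (h *\<^sub>R v))) (at 0)"
      using has_derivative_compose[OF line, of \<rho> ?L] \<rho> by simp
    then have der: "DERIV ?f 0 :> ?L v"
      by (simp add: has_field_derivative_def linear_scale[OF L] mult_commute_abs)
    obtain d where d: "d > 0" "\<And>h. 0 < h \<Longrightarrow> h < d \<Longrightarrow> ?f h < 0"
      using DERIV_neg_dec_right[OF der v] by (auto simp: \<rho>x)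
    obtain d' where d': "d' > 0" "\<And>h. 0 < h \<Longrightarrow> h < d' \<Longrightarrow> 0 < \<rho> (x - h *\<^sub>R v)"
      using DERIV_neg_dec_left[OF der v] by (auto simp: \<rho>x)
    have "((\<lambda>h. x + h *\<^sub>R v) \<longlongrightarrow> x) (at_right 0)" "((\<lambda>h. x - h *\<^sub>R v) \<longlongrightarrow> x) (at_right 0)"
      by (auto intro!: tendsto_eq_intros)
    from this[THEN topological_tendstoD, OF U(1,2)]
    have "\<forall>\<^sub>F h in at_right 0. x + h *\<^sub>R v \<in> U" "\<forall>\<^sub>F h in at_right 0. x - h *\<^sub>R v \<in> U" .
    moreover have "\<forall>\<^sub>F h in at_right 0. 0 < h \<and> h < min d d'"
      using d(1) d'(1) by (auto simp: eventually_at_right_field intro!: exI[of _ "min d d'"])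
    ultimately show ?thesis
    proof eventually_elim
      case (elim h)
      then have "\<rho> (x + h *\<^sub>R v) < 0" "\<not> \<rho> (x - h *\<^sub>R v) < 0"
        using d(2)[of h] d'(2)[of h] by auto
      then show ?case
        using elim U(5) by blast
    qed
  qed
  then show ?thesis
    using that[OF L] U(2,4) by blast
qed

context axial_domain
begin

text \<open>
  A direction orthogonal to the axis cannot be transversal to the boundary at an axis point, since
  the points on both sides along it have the same projection.  Hence the axis itself is transversal
  and runs into the domain on one side.
\<close>

lemma axis_boundary_point:
  assumes smooth: "smooth_boundary \<Omega>" and z: "z \<in> closure D" "Im z = 0"
  shows "z \<in> closure {z \<in> D. Im z = 0}"
proof (cases "z \<in> D")
  case True
  with z(2) show ?thesis
    using closure_subset by fastforce
next
  case False
  define x :: "'n space" where "x = (Re z, 0)"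
  have proj_x: "axial_proj x = z"
    using z(2) by (simp add: x_def axial_proj_def complex_eq_iff)
  have "x \<in> frontier \<Omega>"
    using False z(1) by (simp add: mem_frontier_iff half_plane_boundary_eq proj_x)
  then obtain L :: "'n space \<Rightarrow> real" where L: "linear L" "L \<noteq> (\<lambda>_. 0)"
    "\<And>v. L v < 0 \<Longrightarrow> \<forall>\<^sub>F h in at_right 0. x + h *\<^sub>R v \<in> \<Omega> \<and> x - h *\<^sub>R v \<notin> \<Omega>"
    by (rule smooth_boundary_crossing[OF smooth]) (rule that)
  have "\<not> L (0, u) < 0" for u
  proof
    assume "L (0, u) < 0"
    from eventually_happens'[OF _ L(3)[OF this]]
    obtain h where "x + h *\<^sub>R (0, u) \<in> \<Omega>" "x - h *\<^sub>R (0, u) \<notin> \<Omega>"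
      by auto
    moreover have "axial_proj (x + h *\<^sub>R (0, u)) = axial_proj (x - h *\<^sub>R (0, u))"
      by (simp add: x_def axial_proj_def)
    ultimately show False
      by (simp add: mem_domain_iff)
  qed
  moreover have "L (0, - u) = - L (0, u)" for u
    using linear_neg[OF L(1), of "(0, u)"] by simp
  ultimately have L0: "L (0, u) = 0" for u
    by (metis linorder_neqE neg_less_0_iff_less)
  have "L (1, 0) \<noteq> 0"
  proof
    assume "L (1, 0) = 0"
    then have "L v = 0" for v
      using L0 linear_add[OF L(1), of "fst v *\<^sub>R (1, 0)" "(0, snd v)"] linear_scale[OF L(1), of "fst v" "(1, 0)"]
      by simp
    with L(2) show False by blast
  qed
  \<comment> \<open>the sign of \<sigma> selects the side on which the axis enters the domain\<close>
  moreover define \<sigma> where "\<sigma> = - L (1, 0)"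
  moreover have "L (\<sigma>, 0) = \<sigma> * L (1, 0)"
    using linear_scale[OF L(1), of \<sigma> "(1, 0)"] by simp
  ultimately have "L (\<sigma>, 0) < 0"
    by (auto simp: zero_less_mult_iff linorder_neq_iff)
  show ?thesis
  proof (rule Lim_in_closed_set[OF closed_closure])
    show "\<forall>\<^sub>F h in at_right 0. axial_proj (x + h *\<^sub>R (\<sigma>, 0)) \<in> closure {z \<in> D. Im z = 0}"
      using L(3)[OF \<open>L (\<sigma>, 0) < 0\<close>]
    proof eventually_elim
      case (elim h)
      then have "axial_proj (x + h *\<^sub>R (\<sigma>, 0)) \<in> {z \<in> D. Im z = 0}"
        by (simp add: mem_domain_iff Im_axial_proj x_def)
      then show ?case
        by (rule subsetD[OF closure_subset])
    qed
    have "axial_proj (x + h *\<^sub>R (\<sigma>, 0)) = z + of_real (h * \<sigma>)" for h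
      using z(2) by (simp add: axial_proj_def x_def complex_eq_iff)
    then show "((\<lambda>h. axial_proj (x + h *\<^sub>R (\<sigma>, 0))) \<longlongrightarrow> z) (at_right 0)"
      by (auto intro!: tendsto_eq_intros)
  qed simp
qed

end

section \<open>The equivalence of the boundary value problems\<close>

lemma C1_on_cong:
  assumes "\<And>x. x \<in> S \<Longrightarrow> f x = g x"
  shows "C1_on S f \<longleftrightarrow> C1_on S g"
proof -
  have "(f has_derivative f') (at x within S) \<longleftrightarrow> (g has_derivative f') (at x within S)"
    if "x \<in> S" for x f'
    using has_derivative_transform[of x S f g f'] has_derivative_transform[of x S g f f'] that assms
    by auto
  then show ?thesis
    unfolding C1_on_def by (simp cong: ball_cong)
qed

lemma C1_on_compose_bounded_linear:
  assumes C1: "C1_on S f" and L: "bounded_linear L" and l: "bounded_linear l" "l ` T \<subseteq> S"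
  shows "C1_on T (\<lambda>x. L (f (l x)))"
proof -
  obtain f' where f': "\<And>x. x \<in> S \<Longrightarrow> (f has_derivative blinfun_apply (f' x)) (at x within S)"
    "continuous_on S f'"
    using C1 unfolding C1_on_def by blast
  let ?g = "\<lambda>x. Blinfun L o\<^sub>L f' (l x) o\<^sub>L Blinfun l"
  have "((\<lambda>x. L (f (l x))) has_derivative ?g x) (at x within T)" if "x \<in> T" for x
  proof -
    have "(f has_derivative f' (l x)) (at (l x) within l ` T)"
      using l(2) that by (intro has_derivative_subset[OF f'(1)]) auto
    from bounded_linear.has_derivative[OF L
        diff_chain_within[OF bounded_linear_imp_has_derivative[OF l(1)] this]]
    moreover have "blinfun_apply (?g x) = (\<lambda>h. L (f' (l x) (l h)))"
      by (simp add: fun_eq_iff bounded_linear_Blinfun_apply L l(1))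
    ultimately show ?thesis
      by (simp add: o_def)
  qed
  moreover have "continuous_on T ?g"
    by (intro continuous_intros continuous_on_compose2[OF f'(2) linear_continuous_on[OF l(1)] l(2)])
  ultimately show ?thesis
    unfolding C1_on_def by (intro exI[of _ ?g]) simp
qed

lemma cauchy_riemann_cong:
  assumes "open S" "x \<in> S" "\<And>y. y \<in> S \<Longrightarrow> \<phi> y = \<psi> y"
  shows "cauchy_riemann \<phi> x = cauchy_riemann \<psi> x"
proof -
  have "(\<phi> has_derivative F) (at x) \<longleftrightarrow> (\<psi> has_derivative F) (at x)" for F
    using has_derivative_transform_within_open[of \<phi> F x UNIV S \<psi>]
      has_derivative_transform_within_open[of \<psi> F x UNIV S \<phi>] assms by auto
  then show ?thesis
    by (simp add: cauchy_riemann_def frechet_derivative_def)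
qed

lemma monogenic_on_cong:
  assumes "open S" "\<And>y. y \<in> S \<Longrightarrow> \<phi> y = \<psi> y"
  shows "monogenic_on S \<phi> \<longleftrightarrow> monogenic_on S \<psi>"
  unfolding monogenic_on_def
  by (intro arg_cong2[where f = "(\<and>)"] C1_on_cong ball_cong refl assms(2)
      arg_cong[where f = "\<lambda>a. a = 0"] cauchy_riemann_cong[OF assms(1)])

context axial_domain
begin

text \<open>
  At an axis point the directions \<omega> and -\<omega> must give the same value of \<phi>, which forces
  w to equal its conjugate; if w is real there, then the value does not depend on the direction.
\<close>

lemma corresponds_iff:
  "corresponds \<Omega> \<phi> w \<longleftrightarrow> (\<forall>x\<in>closure \<Omega>. \<phi> x = axial_fun w x) \<and>
     (\<forall>z\<in>closure D. Im z = 0 \<longrightarrow> Im (w z) = 0)"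
proof (intro iffI conjI ballI impI)
  assume corr: "corresponds \<Omega> \<phi> w"
  have at_direction: "\<phi> x = axial_value \<omega> (w (axial_proj x))"
    if "x \<in> closure \<Omega>" "norm \<omega> = 1" "snd x = norm (snd x) *\<^sub>R \<omega>" for x \<omega>
    using corr that unfolding corresponds_def axial_on_iff by simp
  show real: "Im (w z) = 0" if z: "z \<in> closure D" "Im z = 0" for z
  proof -
    obtain \<omega> :: "(real, 'n) vec" where \<omega>: "norm \<omega> = 1"
      by (rule direction_exists)
    let ?x = "meridian \<omega> z"
    have x: "?x \<in> closure \<Omega>" "snd ?x = 0" "axial_proj ?x = z"
      using z \<omega> by (simp_all add: meridian_in_closure axial_proj_meridian, simp add: meridian_def)
    have "axial_value \<omega> (w z) = axial_value (- \<omega>) (w z)"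
      using at_direction[OF x(1), of \<omega>] at_direction[OF x(1), of "- \<omega>"] \<omega> x by simp
    also have "\<dots> = axial_value \<omega> (cnj (w z))"
      by (simp add: axial_value_def linear_neg[OF linear_vec_embed])
    finally show ?thesis
      by (simp add: axial_value_eq_iff[OF \<omega>] complex_eq_iff)
  qed
  show "\<phi> x = axial_fun w x" if x: "x \<in> closure \<Omega>" for x
  proof (cases "snd x = 0")
    case True
    obtain \<omega> :: "(real, 'n) vec" where \<omega>: "norm \<omega> = 1"
      by (rule direction_exists)
    have "Im (w (axial_proj x)) = 0"
      using x True by (intro real) (simp_all add: mem_closure_iff Im_axial_proj)
    then show ?thesis
      using at_direction[OF x \<omega>] True by (simp add: axial_fun_def axial_value_def)
  next
    case False
    then show ?thesis
      using at_direction[OF x, of "sgn (snd x)"] by (simp add: axial_fun_def norm_sgn) (simp add: sgn_div_norm)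
  qed
next
  assume R: "(\<forall>x\<in>closure \<Omega>. \<phi> x = axial_fun w x) \<and> (\<forall>z\<in>closure D. Im z = 0 \<longrightarrow> Im (w z) = 0)"
  have "\<phi> x = axial_value \<omega> (w (axial_proj x))"
    if x: "x \<in> closure \<Omega>" "norm \<omega> = 1" "snd x = norm (snd x) *\<^sub>R \<omega>" for x \<omega>
  proof (cases "snd x = 0")
    case True
    then have "Im (w (axial_proj x)) = 0"
      using R x(1) by (simp add: mem_closure_iff Im_axial_proj)
    then show ?thesis
      using R x(1) by (simp add: axial_fun_def axial_value_def)
  next
    case False
    then have "sgn (snd x) = \<omega>"
      using x(3) by (metis divideR_right norm_eq_zero sgn_div_norm)
    then show ?thesis
      using R x(1) by (simp add: axial_fun_def)
  qed
  then show "corresponds \<Omega> \<phi> w"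
    unfolding corresponds_def axial_on_iff by simp
qed

lemma corresponding_value:
  assumes "corresponds \<Omega> \<phi> w" "norm \<omega> = 1" "z \<in> closure D"
  shows "\<phi> (meridian \<omega> z) = axial_value \<omega> (w z)"
proof -
  have "snd (meridian \<omega> z) = norm (snd (meridian \<omega> z)) *\<^sub>R \<omega>"
    using assms(2) Im_nonneg_closure[OF assms(3)] by (simp add: meridian_def)
  with assms show ?thesis
    unfolding corresponds_def axial_on_iff
    using meridian_in_closure Im_nonneg_closure axial_proj_meridian by fastforce
qed

lemma corresponding_components:
  assumes "corresponds \<Omega> \<phi> w" "norm \<omega> = 1" "z \<in> closure D"
  shows "w z = axial_components \<omega> (\<phi> (meridian \<omega> z))"
  using assms by (simp add: corresponding_value axial_components_axial_value)

lemma corresponding_continuous_iff: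
  assumes corr: "corresponds \<Omega> \<phi> w"
  shows "continuous_on (closure \<Omega>) \<phi> \<longleftrightarrow> continuous_on (closure D) w"
proof
  assume \<phi>: "continuous_on (closure \<Omega>) \<phi>"
  obtain \<omega> :: "(real, 'n) vec" where \<omega>: "norm \<omega> = 1"
    by (rule direction_exists)
  have "continuous_on (closure D) (\<lambda>z. axial_components \<omega> (\<phi> (meridian \<omega> z)))"
    using \<omega> by (intro linear_continuous_on_compose[OF _ bounded_linear.linear[OF bounded_linear_axial_components]]
      continuous_on_compose2[OF \<phi> continuous_on_meridian]) (auto simp: meridian_in_closure)
  then show "continuous_on (closure D) w"
    using corresponding_components[OF corr \<omega>] by (simp cong: continuous_on_cong)
next
  assume w: "continuous_on (closure D) w"
  have "continuous_on (closure \<Omega>) (axial_fun w)"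
  proof (rule continuous_on_axial_fun)
    show "continuous_on (axial_proj ` closure \<Omega>) w"
      by (rule continuous_on_subset[OF w]) (auto simp: mem_closure_iff)
  qed (use corr in \<open>auto simp: corresponds_iff mem_closure_iff Im_axial_proj\<close>)
  then show "continuous_on (closure \<Omega>) \<phi>"
    using corr by (simp add: corresponds_iff cong: continuous_on_cong)
qed

lemma corresponding_monogenic_iff:
  assumes corr: "corresponds \<Omega> \<phi> w"
  shows "monogenic_on \<Omega> \<phi> \<longleftrightarrow>
    C1_on D w \<and> (\<forall>z\<in>D. 0 < Im z \<longrightarrow> vekua_expr CARD('n) w z = 0)"
proof
  have "monogenic_on \<Omega> \<phi> \<longleftrightarrow> monogenic_on \<Omega> (axial_fun w)"
    using corr closure_subset[of \<Omega>]
    by (intro monogenic_on_cong open_domain) (auto simp: corresponds_iff)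
  moreover assume "monogenic_on \<Omega> \<phi>"
  ultimately have mono: "monogenic_on \<Omega> \<phi>" "monogenic_on \<Omega> (axial_fun w)"
    by simp_all
  obtain \<omega> :: "(real, 'n) vec" where \<omega>: "norm \<omega> = 1"
    by (rule direction_exists)
  have "C1_on D (\<lambda>z. axial_components \<omega> (\<phi> (meridian \<omega> z)))"
    using mono(1) meridian_in_domain[OF _ \<omega>] unfolding monogenic_on_def
    by (intro C1_on_compose_bounded_linear[where S = \<Omega> and f = \<phi> and l = "meridian \<omega>"
          and L = "axial_components \<omega>"] bounded_linear_axial_components bounded_linear_meridian)
      blast+
  then have C1: "C1_on D w"
    using corresponding_components[OF corr \<omega>] closure_subset[of D]
    by (subst C1_on_cong) auto
  then obtain w' where "\<And>z. z \<in> D \<Longrightarrow> (w has_derivative blinfun_apply (w' z)) (at z within D)"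
    "continuous_on D w'"
    unfolding C1_on_def by blast
  then interpret C1_in_axial_domain \<Omega> D w w'
    by unfold_locales
  show "C1_on D w \<and> (\<forall>z\<in>D. 0 < Im z \<longrightarrow> vekua_expr CARD('n) w z = 0)"
    using C1 mono(2) vekua_if_monogenic by (simp add: monogenic_on_def)
next
  assume w: "C1_on D w \<and> (\<forall>z\<in>D. 0 < Im z \<longrightarrow> vekua_expr CARD('n) w z = 0)"
  then obtain w' where w': "\<And>z. z \<in> D \<Longrightarrow> (w has_derivative blinfun_apply (w' z)) (at z within D)"
    "continuous_on D w'"
    unfolding C1_on_def by blast
  have "Im (w z) = 0" if "z \<in> D" "Im z = 0" for z
    using corr that closure_subset[of D] by (auto simp: corresponds_iff)
  with w w' interpret vekua_solution \<Omega> D w w'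
    by unfold_locales auto
  have "monogenic_on \<Omega> \<phi> \<longleftrightarrow> monogenic_on \<Omega> (axial_fun w)"
    using corr closure_subset[of \<Omega>]
    by (intro monogenic_on_cong open_domain) (auto simp: corresponds_iff)
  then show "monogenic_on \<Omega> \<phi>"
    using monogenic_axial_fun by simp
qed

lemma corresponding_boundary_iff:
  assumes corr: "corresponds \<Omega> \<phi> w" and \<Lambda>: "axial_on (frontier \<Omega>) \<Lambda> \<Lambda>\<^sub>1 \<Lambda>\<^sub>2"
    and g: "\<And>t. t \<in> frontier \<Omega> \<Longrightarrow> g t = g\<^sub>D (axial_proj t)"
  shows "(\<forall>t\<in>frontier \<Omega>. Sc (\<Lambda> t * \<phi> t) = g t) \<longleftrightarrow>
    (\<forall>z\<in>half_plane_boundary D.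
      Re ((complex_of_real (\<Lambda>\<^sub>1 z) + \<i> * complex_of_real (\<Lambda>\<^sub>2 z)) * w z) = g\<^sub>D z)"
proof -
  have Sc: "Sc (\<Lambda> t * \<phi> t) = Re (Complex (\<Lambda>\<^sub>1 (axial_proj t)) (\<Lambda>\<^sub>2 (axial_proj t)) * w (axial_proj t))"
    if t: "t \<in> frontier \<Omega>" for t
  proof -
    obtain \<omega> where \<omega>: "norm \<omega> = 1" "snd t = norm (snd t) *\<^sub>R \<omega>"
      by (rule direction_exists)
    then have "\<Lambda> t = axial_value \<omega> (Complex (\<Lambda>\<^sub>1 (axial_proj t)) (\<Lambda>\<^sub>2 (axial_proj t)))"
      using \<Lambda> t unfolding axial_on_iff by simp
    moreover have "\<phi> t = axial_value \<omega> (w (axial_proj t))"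
      using corr t \<omega> unfolding corresponds_def axial_on_iff frontier_def by simp
    ultimately show ?thesis
      by (simp only: Sc_mult_axial_value[OF \<omega>(1)])
  qed
  obtain \<omega> :: "(real, 'n) vec" where \<omega>: "norm \<omega> = 1"
    by (rule direction_exists)
  have onto: "half_plane_boundary D = axial_proj ` frontier \<Omega>"
  proof (intro equalityI subsetI)
    fix z assume z: "z \<in> half_plane_boundary D"
    then have "axial_proj (meridian \<omega> z) = z"
      using \<omega> Im_nonneg_closure by (simp add: half_plane_boundary_eq axial_proj_meridian)
    with z show "z \<in> axial_proj ` frontier \<Omega>"
      by (metis imageI mem_frontier_iff)
  qed (auto simp: mem_frontier_iff)
  show ?thesis
    unfolding onto by (simp add: Sc g Complex_eq)
qed

lemma corresponding_RHP_iff: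
  assumes corr: "corresponds \<Omega> \<phi> w" and \<Lambda>: "axial_on (frontier \<Omega>) \<Lambda> \<Lambda>\<^sub>1 \<Lambda>\<^sub>2"
    and g: "\<And>t. t \<in> frontier \<Omega> \<Longrightarrow> g t = g\<^sub>D (axial_proj t)"
  shows "clifford_RHP \<Omega> \<Lambda> g \<phi> \<longleftrightarrow>
    vekua_RHP CARD('n) D (\<lambda>z. complex_of_real (\<Lambda>\<^sub>1 z) + \<i> * complex_of_real (\<Lambda>\<^sub>2 z)) g\<^sub>D w"
proof -
  have "axial_on \<Omega> \<phi> (\<lambda>z. Re (w z)) (\<lambda>z. Im (w z))"
    using corr closure_subset[of \<Omega>] unfolding corresponds_def axial_on_def by blast
  then have "axially_monogenic_on \<Omega> \<phi> \<longleftrightarrow> monogenic_on \<Omega> \<phi>"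
    unfolding axially_monogenic_on_def by blast
  then show ?thesis
    using corresponding_boundary_iff[where g = g and g\<^sub>D = g\<^sub>D, OF corr \<Lambda> g]
    unfolding clifford_RHP_def vekua_RHP_def vekua_expr_def[symmetric]
      corresponding_monogenic_iff[OF corr] corresponding_continuous_iff[OF corr]
    by auto
qed

text \<open>
  Axial type is known on the domain only.  Reading off w along one fixed meridian extends the
  components continuously to the closure, and by continuity the same w serves all directions there.
\<close>

lemma axially_monogenic_has_corresponding:
  assumes axial: "axial_on \<Omega> \<phi> A B" and cont: "continuous_on (closure \<Omega>) \<phi>"
  obtains w where "corresponds \<Omega> \<phi> w"
proof -
  obtain \<omega>\<^sub>0 :: "(real, 'n) vec" where \<omega>\<^sub>0: "norm \<omega>\<^sub>0 = 1"
    by (rule direction_exists)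
  define w where "w z = axial_components \<omega>\<^sub>0 (\<phi> (meridian \<omega>\<^sub>0 z))" for z
  have along: "continuous_on (closure D) (\<lambda>z. \<phi> (meridian \<omega> z))" if "norm \<omega> = 1" for \<omega>
    using that by (intro continuous_on_compose2[OF cont continuous_on_meridian])
      (auto simp: meridian_in_closure)
  have on_domain: "\<phi> (meridian \<omega> z) = axial_value \<omega> (Complex (A z) (B z))"
    if "norm \<omega> = 1" "z \<in> D" for \<omega> z
  proof -
    have "snd (meridian \<omega> z) = norm (snd (meridian \<omega> z)) *\<^sub>R \<omega>"
      using that Im_nonneg by (simp add: meridian_def)
    with axial that show ?thesis
      unfolding axial_on_iff
      using meridian_in_domain[OF that(2,1)] axial_proj_meridian[OF that(1) Im_nonneg[OF that(2)]]
      by fastforce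
  qed
  have "\<phi> (meridian \<omega> z) - axial_value \<omega> (w z) = 0" if \<omega>: "norm \<omega> = 1" and z: "z \<in> closure D" for \<omega> z
  proof (rule continuous_constant_on_closure[OF _ _ z])
    show "continuous_on (closure D) (\<lambda>z. \<phi> (meridian \<omega> z) - axial_value \<omega> (w z))"
      unfolding w_def
      by (intro continuous_on_diff along \<omega> \<omega>\<^sub>0
          bounded_linear.continuous_on[OF bounded_linear_axial_value]
          bounded_linear.continuous_on[OF bounded_linear_axial_components])
    show "\<phi> (meridian \<omega> z) - axial_value \<omega> (w z) = 0" if "z \<in> D" for z
      by (simp add: w_def on_domain that \<omega> \<omega>\<^sub>0 axial_components_axial_value)
  qed
  then have "corresponds \<Omega> \<phi> w"
    unfolding corresponds_def axial_on_iff
    by (metis complex_surj eq_iff_diff_eq_0 mem_closure_iff meridian_axial_proj)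
  then show ?thesis
    by (rule that)
qed

text \<open>
  What has to be shown is that w is real on all axis points of the closure: on those in D because of
  the equation, or for n = 1 by assumption, and on the others as limits of those.
\<close>

lemma axial_fun_corresponds:
  assumes smooth: "smooth_boundary \<Omega>" and w: "vekua_RHP CARD('n) D \<Lambda> g w"
    and real: "CARD('n) = 1 \<Longrightarrow> \<forall>z\<in>D. Im z = 0 \<longrightarrow> Im (w z) = 0"
  shows "corresponds \<Omega> (axial_fun w) w"
proof -
  obtain w' where "\<And>z. z \<in> D \<Longrightarrow> (w has_derivative blinfun_apply (w' z)) (at z within D)"
    "continuous_on D w'"
    using w unfolding vekua_RHP_def C1_on_def by blast
  then interpret C1_in_axial_domain \<Omega> D w w'
    by unfold_locales
  have "vekua_expr CARD('n) w z = 0" if "z \<in> D" "0 < Im z" for z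
    using w that unfolding vekua_RHP_def vekua_expr_def by blast
  then have axis: "Im (w z) = 0" if "z \<in> D" "Im z = 0" for z
    using vekua_solution_real_on_axis[of "CARD('n)" z] real that by blast
  have "Im (w z) = 0" if z: "z \<in> closure D" "Im z = 0" for z
  proof (rule continuous_constant_on_closure[OF _ _ axis_boundary_point[OF smooth z]])
    have "closure {z \<in> D. Im z = 0} \<subseteq> closure D"
      by (rule closure_mono) auto
    then show "continuous_on (closure {z \<in> D. Im z = 0}) (\<lambda>z. Im (w z))"
      using w unfolding vekua_RHP_def by (auto intro: continuous_on_Im continuous_on_subset)
  qed (simp add: axis)
  then show ?thesis
    by (simp add: corresponds_iff)
qed

end

theorem theorem3p1:
  fixes \<Omega> :: "'n::{finite,linorder} space set"
    and \<Lambda> :: "'n space \<Rightarrow> 'n clifford"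
    and g :: "'n space \<Rightarrow> real"
    and D :: "complex set"
    and \<Lambda>\<^sub>1 \<Lambda>\<^sub>2 g\<^sub>D :: "complex \<Rightarrow> real"
    and \<Lambda>\<^sub>D :: "complex \<Rightarrow> complex"
  defines "D \<equiv> axial_proj ` \<Omega>"
    and "\<Lambda>\<^sub>D \<equiv> \<lambda>z. complex_of_real (\<Lambda>\<^sub>1 z) + \<i> * complex_of_real (\<Lambda>\<^sub>2 z)"
  assumes domain: "open \<Omega>" "connected \<Omega>"
    and symmetric: "axially_symmetric \<Omega>"
    and smooth: "smooth_boundary \<Omega>"
    and \<Lambda>_axial: "axial_on (frontier \<Omega>) \<Lambda> \<Lambda>\<^sub>1 \<Lambda>\<^sub>2"
    and g_axial: "\<And>t. t \<in> frontier \<Omega> \<Longrightarrow> g t = g\<^sub>D (axial_proj t)"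
  shows "(\<forall>\<phi> w. corresponds \<Omega> \<phi> w \<longrightarrow>
            (clifford_RHP \<Omega> \<Lambda> g \<phi> \<longleftrightarrow> vekua_RHP CARD('n) D \<Lambda>\<^sub>D g\<^sub>D w))
       \<and> (\<forall>\<phi>. clifford_RHP \<Omega> \<Lambda> g \<phi> \<longrightarrow>
            (\<exists>w. corresponds \<Omega> \<phi> w \<and> vekua_RHP CARD('n) D \<Lambda>\<^sub>D g\<^sub>D w))
       \<and> (\<forall>w. vekua_RHP CARD('n) D \<Lambda>\<^sub>D g\<^sub>D w \<and>
              (CARD('n) = 1 \<longrightarrow> (\<forall>z\<in>D. Im z = 0 \<longrightarrow> Im (w z) = 0)) \<longrightarrow>
            (\<exists>\<phi>. corresponds \<Omega> \<phi> w \<and> clifford_RHP \<Omega> \<Lambda> g \<phi>))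
       \<and> (\<forall>\<phi> \<phi>' w. corresponds \<Omega> \<phi> w \<and> corresponds \<Omega> \<phi>' w \<longrightarrow>
            (\<forall>x\<in>closure \<Omega>. \<phi> x = \<phi>' x))
       \<and> (\<forall>\<phi> w w'. corresponds \<Omega> \<phi> w \<and> corresponds \<Omega> \<phi> w' \<longrightarrow>
            (\<forall>z\<in>closure D. w z = w' z))"
proof -
  interpret axial_domain \<Omega> D
    by (rule axial_domain.intro[OF domain(1) symmetric]) (simp add: D_def)
  have equivalent: "clifford_RHP \<Omega> \<Lambda> g \<phi> \<longleftrightarrow> vekua_RHP CARD('n) D \<Lambda>\<^sub>D g\<^sub>D w"
    if "corresponds \<Omega> \<phi> w" for \<phi> w
    unfolding \<Lambda>\<^sub>D_def by (rule corresponding_RHP_iff[OF that \<Lambda>_axial]) (rule g_axial)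
  show ?thesis
  proof (intro conjI allI impI ballI)
    show "clifford_RHP \<Omega> \<Lambda> g \<phi> \<longleftrightarrow> vekua_RHP CARD('n) D \<Lambda>\<^sub>D g\<^sub>D w"
      if "corresponds \<Omega> \<phi> w" for \<phi> w
      by (rule equivalent[OF that])
    show "\<exists>w. corresponds \<Omega> \<phi> w \<and> vekua_RHP CARD('n) D \<Lambda>\<^sub>D g\<^sub>D w"
      if solution: "clifford_RHP \<Omega> \<Lambda> g \<phi>" for \<phi>
    proof -
      obtain A B where "axial_on \<Omega> \<phi> A B" "continuous_on (closure \<Omega>) \<phi>"
        using solution unfolding clifford_RHP_def axially_monogenic_on_def by blast
      then obtain w where "corresponds \<Omega> \<phi> w"
        by (rule axially_monogenic_has_corresponding)
      with solution equivalent show ?thesis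
        by blast
    qed
    show "\<exists>\<phi>. corresponds \<Omega> \<phi> w \<and> clifford_RHP \<Omega> \<Lambda> g \<phi>"
      if w: "vekua_RHP CARD('n) D \<Lambda>\<^sub>D g\<^sub>D w \<and>
        (CARD('n) = 1 \<longrightarrow> (\<forall>z\<in>D. Im z = 0 \<longrightarrow> Im (w z) = 0))" for w
    proof -
      have "corresponds \<Omega> (axial_fun w) w"
        using w by (intro axial_fun_corresponds[OF smooth]) blast+
      with w equivalent show ?thesis
        by blast
    qed
    show "\<phi> x = \<phi>' x"
      if "corresponds \<Omega> \<phi> w \<and> corresponds \<Omega> \<phi>' w" "x \<in> closure \<Omega>" for \<phi> \<phi>' w x
      using that by (simp add: corresponds_iff)
    show "w z = w' z"
      if "corresponds \<Omega> \<phi> w \<and> corresponds \<Omega> \<phi> w'" "z \<in> closure D" for \<phi> w w' z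
    proof -
      obtain \<omega> :: "(real, 'n) vec" where "norm \<omega> = 1"
        by (rule direction_exists)
      with that show ?thesis
        using corresponding_components[of \<phi> w \<omega> z] corresponding_components[of \<phi> w' \<omega> z]
        by simp
    qed
  qed
qed

end
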